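(* Let $n$ be a positive integer, let $(\mathcal{P},\mathcal{L})$ be a connected Fischer space of rank $n$, and let $\mathbb{F}$ be a field of characteristic $3$. Then the Matsuo algebra $M((\mathcal{P},\mathcal{L}),\frac14,\mathbb{F})$ is a Jordan algebra if and only if $(\mathcal{P},\mathcal{L})$ is isomorphic to either the Fischer space associated with the $3$-transposition group $(\mathit{Sym}(n+1),(1,2)^{\mathit{Sym}(n+1)})$, or the $(n-1)$-dimensional affine space $AG(n-1,3)$ of order three.
   Context: Partial triple systems. A partial triple system is a pair $(\mathcal{P},\mathcal{L})$ where $\mathcal{P}$ is a set (of points) and $\mathcal{L}$ is a set of $3$-element subsets of $\mathcal{P}$ (lines) such that $|l_1\cap l_2|\le 1$ for all distinct $l_1,l_2\in\mathcal{L}$. Two distinct points are collinear if they lie on a common line. A subsystem of $(\mathcal{P},\mathcal{L})$ is a partial triple system $(\mathcal{P}',\mathcal{L}')$ with $\mathcal{P}'\subset\mathcal{P}$ and $\mathcal{L}\supset\mathcal{L}'\supset\{l\in\mathcal{L} : |l\cap\mathcal{P}'|\ge 2\}$. The subsystem generated by a subset $S\subset\mathcal{P}$ is the minimum subsystem whose point set contains $S$. The rank of $(\mathcal{P},\mathcal{L})$ is the minimum size of a subset of $\mathcal{P}$ generating $(\mathcal{P},\mathcal{L})$ itself. A plane is a subsystem generated by $l_1\cup l_2$ for two distinct intersecting lines $l_1,l_2$. Two partial triple systems are isomorphic if there is a bijection between the point sets inducing a bijection between the line sets. $(\mathcal{P},\mathcal{L})$ is connected if the equivalence relation on $\mathcal{P}$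 generated by collinearity has exactly one class. Examples. The dual affine plane $DA(2,2)$ of order two has point set $\{p,q,r,s,t,u\}$ (six distinct points) and line set $\{\{p,r,s\},\{p,t,u\},\{q,r,t\},\{q,s,u\}\}$. The affine space $AG(m,3)$ of order three ($m\ge 0$) has point set $\mathbb{F}_3^m$ and line set $\{\{x,y,-x-y\} : x,y\in\mathbb{F}_3^m,\ x\ne y\}$. Fischer spaces. A Fischer space is a partial triple system each of whose planes is isomorphic to $DA(2,2)$ or $AG(2,3)$. A $3$-transposition group is a pair $(G,D)$ with $G$ a group and $D$ a conjugation-invariant subset of $G$ such that $|g|=2$ and $|gh|\le 3$ for all $g,h\in D$. The Fischer space associated with $(G,D)$ has point set $D$ and line set $\{\{c,d,d^{-1}cd\} : c,d\in D,\ |cd|=3\}$. Here $(1,2)^{\mathit{Sym}(n+1)}$ denotes the set of all transpositions in the symmetric group $\mathit{Sym}(n+1)$. Matsuo algebras. For a partial triple system $(\mathcal{P},\mathcal{L})$, a field $\mathbb{F}$ of characteristic not $2$ and $\delta\in\mathbb{F}$, the Matsuo algebra $M((\mathcal{P},\mathcal{L}),\delta,\mathbb{F})$ is the $\mathbb{F}$-vector space with basis $\{a(p) : p\in\mathcal{P}\}$ and bilinear multiplication given by: $a(p)a(p)=a(p)$; $a(p)a(q)=0$ if $p\ne q$ are not collinear; $a(p)a(q)=\delta(a(p)+a(q)-a(r))$ if $p,q$ are collinear and $\{p,q,r\}$ is the line containing them. A Jordan algebra is a commutative, not necessarily associative, algebra $A$ satisfying $(a^2b)a=a^2(ba)$ for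 all $a,b\in A$. *)

theory Defs
  imports
    "HOL-Library.Poly_Mapping"
    "HOL-Library.Numeral_Type"
    "HOL-Algebra.Sym_Groups"
    "HOL-Algebra.Multiplicative_Group"
begin

section \<open>Partial triple systems\<close>

definition partial_triple_system :: "'a set \<Rightarrow> 'a set set \<Rightarrow> bool" where
  "partial_triple_system P L \<longleftrightarrow>
     (\<forall>l\<in>L. l \<subseteq> P \<and> card l = 3) \<and>
     (\<forall>l1\<in>L. \<forall>l2\<in>L. l1 \<noteq> l2 \<longrightarrow> card (l1 \<inter> l2) \<le> 1)"

definition collinear :: "'a set set \<Rightarrow> 'a \<Rightarrow> 'a \<Rightarrow> bool" where
  "collinear L p q \<longleftrightarrow> p \<noteq> q \<and> (\<exists>l\<in>L. p \<in> l \<and> q \<in> l)"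

definition subsystem :: "'a set \<Rightarrow> 'a set set \<Rightarrow> 'a set \<Rightarrow> 'a set set \<Rightarrow> bool" where
  "subsystem P' L' P L \<longleftrightarrow>
     partial_triple_system P' L' \<and> P' \<subseteq> P \<and> L' \<subseteq> L \<and> {l\<in>L. card (l \<inter> P') \<ge> 2} \<subseteq> L'"

text \<open>\<open>(P', L')\<close> is the minimum subsystem of \<open>(P, L)\<close> whose point set contains \<open>S\<close>.\<close>

definition generated_subsystem ::
    "'a set \<Rightarrow> 'a set set \<Rightarrow> 'a set \<Rightarrow> 'a set \<Rightarrow> 'a set set \<Rightarrow> bool" where
  "generated_subsystem P L S P' L' \<longleftrightarrow>
     subsystem P' L' P L \<and> S \<subseteq> P' \<and>
     (\<forall>P'' L''. subsystem P'' L'' P L \<and> S \<subseteq> P'' \<longrightarrow> P' \<subseteq> P'' \<and> L' \<subseteq> L'')"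

text \<open>A predicate rather than a number, so that a system without a finite generating set
  has no natural number as its rank.\<close>

definition has_rank :: "'a set \<Rightarrow> 'a set set \<Rightarrow> nat \<Rightarrow> bool" where
  "has_rank P L n \<longleftrightarrow>
     (\<exists>S\<subseteq>P. finite S \<and> card S = n \<and> generated_subsystem P L S P L) \<and>
     (\<forall>S\<subseteq>P. finite S \<and> generated_subsystem P L S P L \<longrightarrow> n \<le> card S)"

definition plane :: "'a set \<Rightarrow> 'a set set \<Rightarrow> 'a set \<Rightarrow> 'a set set \<Rightarrow> bool" where
  "plane P L P' L' \<longleftrightarrow>
     (\<exists>l1\<in>L. \<exists>l2\<in>L. l1 \<noteq> l2 \<and> l1 \<inter> l2 \<noteq> {} \<and> generated_subsystem P L (l1 \<union> l2) P' L')"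

definition isomorphic_systems ::
    "'a set \<Rightarrow> 'a set set \<Rightarrow> 'b set \<Rightarrow> 'b set set \<Rightarrow> bool" where
  "isomorphic_systems P L P' L' \<longleftrightarrow>
     (\<exists>f. bij_betw f P P' \<and> bij_betw (\<lambda>l. f ` l) L L')"

definition connected_system :: "'a set \<Rightarrow> 'a set set \<Rightarrow> bool" where
  "connected_system P L \<longleftrightarrow>
     card (P // {(p, q). p \<in> P \<and> q \<in> P \<and> equivclp (collinear L) p q}) = 1"


section \<open>Dual affine plane of order two, affine spaces of order three\<close>

text \<open>The points \<open>p, q, r, s, t, u\<close> are \<open>0, 1, 2, 3, 4, 5\<close>.\<close>

definition dual_affine_points :: "nat set" where
  "dual_affine_points = {0, 1, 2, 3, 4, 5}"

definition dual_affine_lines :: "nat set set" where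
  "dual_affine_lines = {{0, 2, 3}, {0, 4, 5}, {1, 2, 4}, {1, 3, 5}}"

text \<open>The numeral type \<open>3\<close> carries arithmetic modulo 3; a vector with \<open>m\<close> coordinates is a
  sequence vanishing from index \<open>m\<close> on.\<close>

definition affine_points :: "nat \<Rightarrow> (nat \<Rightarrow> 3) set" where
  "affine_points m = {x. \<forall>i\<ge>m. x i = 0}"

definition affine_lines :: "nat \<Rightarrow> (nat \<Rightarrow> 3) set set" where
  "affine_lines m =
     {{x, y, (\<lambda>i. - x i - y i)} | x y. x \<in> affine_points m \<and> y \<in> affine_points m \<and> x \<noteq> y}"


section \<open>Fischer spaces\<close>

definition fischer_space :: "'a set \<Rightarrow> 'a set set \<Rightarrow> bool" where
  "fischer_space P L \<longleftrightarrow>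
     partial_triple_system P L \<and>
     (\<forall>P' L'. plane P L P' L' \<longrightarrow>
        isomorphic_systems P' L' dual_affine_points dual_affine_lines \<or>
        isomorphic_systems P' L' (affine_points 2) (affine_lines 2))"

text \<open>The Fischer space associated with a 3-transposition group \<open>(G, D)\<close> has point set \<open>D\<close>
  and the following lines.\<close>

definition fischer_lines :: "('g, 'm) monoid_scheme \<Rightarrow> 'g set \<Rightarrow> 'g set set" where
  "fischer_lines G D =
     {{c, d, inv\<^bsub>G\<^esub> d \<otimes>\<^bsub>G\<^esub> c \<otimes>\<^bsub>G\<^esub> d} | c d. c \<in> D \<and> d \<in> D \<and> group.ord G (c \<otimes>\<^bsub>G\<^esub> d) = 3}"

text \<open>The transpositions in \<open>sym_group m\<close>, which acts on \<open>{1..m}\<close>.\<close>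

definition transpositions :: "nat \<Rightarrow> (nat \<Rightarrow> nat) set" where
  "transpositions m = {transpose i j | i j. i \<in> {1..m} \<and> j \<in> {1..m} \<and> i \<noteq> j}"


section \<open>Matsuo algebras\<close>

definition pm_scale :: "'f::field \<Rightarrow> ('a \<Rightarrow>\<^sub>0 'f) \<Rightarrow> ('a \<Rightarrow>\<^sub>0 'f)" where
  "pm_scale c x = Poly_Mapping.map ((*) c) x"

definition matsuo_carrier :: "'a set \<Rightarrow> ('a \<Rightarrow>\<^sub>0 'f::field) set" where
  "matsuo_carrier P = {x. Poly_Mapping.keys x \<subseteq> P}"

definition axis :: "'a \<Rightarrow> ('a \<Rightarrow>\<^sub>0 'f::field)" where
  "axis p = Poly_Mapping.single p 1"

definition third_point :: "'a set set \<Rightarrow> 'a \<Rightarrow> 'a \<Rightarrow> 'a" where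
  "third_point L p q = (THE r. {p, q, r} \<in> L)"

definition axis_mult :: "'a set set \<Rightarrow> 'f::field \<Rightarrow> 'a \<Rightarrow> 'a \<Rightarrow> ('a \<Rightarrow>\<^sub>0 'f)" where
  "axis_mult L \<delta> p q =
     (if p = q then axis p
      else if collinear L p q then pm_scale \<delta> (axis p + axis q - axis (third_point L p q))
      else 0)"

definition matsuo_mult ::
    "'a set set \<Rightarrow> 'f::field \<Rightarrow> ('a \<Rightarrow>\<^sub>0 'f) \<Rightarrow> ('a \<Rightarrow>\<^sub>0 'f) \<Rightarrow> ('a \<Rightarrow>\<^sub>0 'f)" where
  "matsuo_mult L \<delta> x y =
     (\<Sum>p\<in>Poly_Mapping.keys x. \<Sum>q\<in>Poly_Mapping.keys y.
        pm_scale (Poly_Mapping.lookup x p * Poly_Mapping.lookup y q) (axis_mult L \<delta> p q))"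


section \<open>Jordan algebras\<close>

definition algebra_on ::
    "('f::field \<Rightarrow> 'v::ab_group_add \<Rightarrow> 'v) \<Rightarrow> 'v set \<Rightarrow> ('v \<Rightarrow> 'v \<Rightarrow> 'v) \<Rightarrow> bool" where
  "algebra_on sc A mul \<longleftrightarrow>
     vector_space sc \<and> module.subspace sc A \<and>
     (\<forall>x\<in>A. \<forall>y\<in>A. mul x y \<in> A) \<and>
     (\<forall>x\<in>A. \<forall>y\<in>A. \<forall>z\<in>A. mul (x + y) z = mul x z + mul y z \<and> mul x (y + z) = mul x y + mul x z) \<and>
     (\<forall>c. \<forall>x\<in>A. \<forall>y\<in>A. mul (sc c x) y = sc c (mul x y) \<and> mul x (sc c y) = sc c (mul x y))"

definition jordan_algebra ::
    "('f::field \<Rightarrow> 'v::ab_group_add \<Rightarrow> 'v) \<Rightarrow> 'v set \<Rightarrow> ('v \<Rightarrow> 'v \<Rightarrow> 'v) \<Rightarrow> bool" where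
  "jordan_algebra sc A mul \<longleftrightarrow>
     algebra_on sc A mul \<and>
     (\<forall>a\<in>A. \<forall>b\<in>A. mul a b = mul b a) \<and>
     (\<forall>a\<in>A. \<forall>b\<in>A. mul (mul (mul a a) b) a = mul (mul a a) (mul b a))"

end

theory Submission
  imports Defs "HOL-Library.Function_Algebras"
begin

text \<open>
  In characteristic 3 the parameter 1/4 is 1, so collinear axes multiply as \<open>a(p) a(q) = a(p) + a(q) - a(r)\<close>.
  For an affine space the Matsuo algebra is the group algebra of \<open>(\<int>/3)\<^sup>m\<close> with a twisted product, and the
  Jordan identity reduces to the fact that cubes in the group algebra are scalars. For the symmetric group,
  sending a transposition to its permutation matrix minus the identity embeds the Matsuo algebra into a
  special Jordan algebra.

  Conversely, the Jordan identity is polarized and its coefficients are compared. Let \<open>t\<close> be a point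
  outside a plane. If the plane is affine, \<open>t\<close> is collinear with all of its points or with none, so by
  connectedness affine and dual affine planes cannot both occur. If there is an affine plane, the polarized
  identity gives the medial law for the operation ``third point on the line'', which makes the space an affine
  space over the field with three elements. If all planes are dual affine, view such a plane as the six edges
  of a complete graph on four vertices; each of its three pairs of opposite edges contains the same number of
  points collinear with \<open>t\<close>. Hence the points collinear with \<open>t\<close> in a subsystem formed by the
  edges of a complete graph form the star of a vertex, and adding \<open>t\<close> yields the edges of a complete graph
  with one more vertex. Starting from one point of a minimal generating set this exhausts the space.
\<close>

section \<open>Partial triple systems and their subsystems\<close>

text \<open>Geometry alone settles neither case: a space in which all planes are affine need not be
  an affine space, and those with only dual affine planes include ones of symplectic type. The
  Jordan identity enters both through its full polarization on four axes. If \<open>Q\<close> is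
  closed and \<open>t\<close> lies outside, a line joining \<open>t\<close> to a point of
  \<open>Q\<close> has its third point outside \<open>Q\<close>. Read off at points of
  \<open>Q\<close>, multiplication by the axis of \<open>t\<close> therefore only records which
  points are collinear with \<open>t\<close>, and comparing coefficients gives linear relations
  between these 0/1 values.

  The converse cannot run this backwards. At three equal arguments the polarized identity is six
  times the original one, which is zero in characteristic 3, so checking it on axes does not give
  back the identity. Hence both model algebras are embedded into algebras where the identity is
  available for all elements.

  The rank only fixes the size of the model. For edges of a complete graph it is one less than the
  number of vertices, since a star generates; in an affine space a minimal generating set is an
  origin together with a basis.\<close>

definition line_closed :: "'a set set \<Rightarrow> 'a set \<Rightarrow> bool" where
  "line_closed L Q \<longleftrightarrow> (\<forall>p q r. {p, q, r} \<in> L \<longrightarrow> p \<in> Q \<longrightarrow> q \<in> Q \<longrightarrow> r \<in> Q)"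

lemma line_closedD: "line_closed L Q \<Longrightarrow> {p, q, r} \<in> L \<Longrightarrow> p \<in> Q \<Longrightarrow> q \<in> Q \<Longrightarrow> r \<in> Q"
  unfolding line_closed_def by blast

locale pts =
  fixes P :: "'a set" and L :: "'a set set"
  assumes pts: "partial_triple_system P L"
begin

abbreviation col :: "'a \<Rightarrow> 'a \<Rightarrow> bool" where "col \<equiv> collinear L"

abbreviation third :: "'a \<Rightarrow> 'a \<Rightarrow> 'a" where "third \<equiv> third_point L"

lemma line_card: "l \<in> L \<Longrightarrow> card l = 3" and line_subset: "l \<in> L \<Longrightarrow> l \<subseteq> P"
  using pts unfolding partial_triple_system_def by auto

lemma line_distinct:
  assumes "{p, q, r} \<in> L"
  shows "p \<noteq> q" "p \<noteq> r" "q \<noteq> r"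
  using line_card[OF assms] by (auto simp: card_insert_if split: if_splits)

lemma line_points:
  assumes "{p, q, r} \<in> L"
  shows "p \<in> P" "q \<in> P" "r \<in> P"
  using line_subset[OF assms] by auto

lemma line_eqI:
  assumes "l \<in> L" "m \<in> L" "p \<in> l" "q \<in> l" "p \<in> m" "q \<in> m" "p \<noteq> q"
  shows "l = m"
proof (rule ccontr)
  assume "l \<noteq> m"
  then have "card (l \<inter> m) \<le> 1" using pts assms unfolding partial_triple_system_def by auto
  moreover have "finite (l \<inter> m)" using line_card[OF assms(1)] by (metis card.infinite finite_Int zero_neq_numeral)
  moreover have "{p, q} \<subseteq> l \<inter> m" using assms by auto
  ultimately have "card {p, q} \<le> 1" by (meson card_mono order_trans)
  then show False using assms by simp
qed

lemma line_unique: "{p, q, r} \<in> L \<Longrightarrow> {p, q, s} \<in> L \<Longrightarrow> r = s"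
  using line_eqI[of "{p, q, r}" "{p, q, s}" p q] line_distinct by (metis insertCI insertE singletonD)

lemma line_thirdE:
  assumes "l \<in> L" "p \<in> l" "q \<in> l" "p \<noteq> q"
  obtains r where "l = {p, q, r}"
proof -
  have "card (l - {p, q}) = 1"
    using assms line_card[OF assms(1)] by (simp add: card_Diff_subset)
  then obtain r where "l - {p, q} = {r}" using card_1_singletonE by blast
  then have "l = {p, q, r}" using assms by auto
  then show ?thesis by (rule that)
qed

lemma lineE:
  assumes "l \<in> L"
  obtains p q r where "l = {p, q, r}"
  using line_card[OF assms] by (auto simp: card_3_iff)

lemma col_iff: "col p q \<longleftrightarrow> (\<exists>r. {p, q, r} \<in> L)"
proof
  assume "col p q"
  then show "\<exists>r. {p, q, r} \<in> L" unfolding collinear_def by (metis line_thirdE)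
next
  assume "\<exists>r. {p, q, r} \<in> L"
  then show "col p q" unfolding collinear_def using line_distinct by blast
qed

lemma col_sym: "col p q \<longleftrightarrow> col q p"
  unfolding collinear_def by auto

lemma col_points: "col p q \<Longrightarrow> p \<in> P" "col p q \<Longrightarrow> q \<in> P"
  by (auto simp: col_iff dest: line_points)

lemma col_neq: "col p q \<Longrightarrow> p \<noteq> q"
  by (simp add: collinear_def)

lemma line_col:
  assumes "{p, q, r} \<in> L"
  shows "col p q" "col q p" "col p r" "col r p" "col q r" "col r q"
  using line_distinct[OF assms] unfolding collinear_def by (auto intro!: bexI[OF _ assms])

lemma third_eq: "{p, q, r} \<in> L \<Longrightarrow> third p q = r"
  unfolding third_point_def by (auto intro: line_unique)

lemma third_line: "col p q \<Longrightarrow> {p, q, third p q} \<in> L"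
  unfolding col_iff using third_eq by auto

lemma third_commute: "third p q = third q p"
  unfolding third_point_def by (simp add: insert_commute)

lemma third_closed: "line_closed L Q \<Longrightarrow> col p q \<Longrightarrow> p \<in> Q \<Longrightarrow> q \<in> Q \<Longrightarrow> third p q \<in> Q"
  using line_closedD third_line by metis

lemma line_closed_subsystem:
  assumes "line_closed L Q" "Q \<subseteq> P"
  shows "subsystem Q {l \<in> L. 2 \<le> card (l \<inter> Q)} P L"
proof -
  have "l \<subseteq> Q" if l: "l \<in> L" "2 \<le> card (l \<inter> Q)" for l
  proof -
    have "\<not> card (l \<inter> Q) \<le> Suc 0" using l by simp
    moreover have "finite (l \<inter> Q)" using l by (metis card.infinite not_numeral_le_zero)
    ultimately obtain p q where pq: "p \<in> l \<inter> Q" "q \<in> l \<inter> Q" "p \<noteq> q"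
      using card_le_Suc0_iff_eq by blast
    then obtain r where "l = {p, q, r}" using line_thirdE[OF l(1)] by blast
    then show ?thesis using line_closedD[OF assms(1), of p q r] l pq by auto
  qed
  then show ?thesis
    using assms pts unfolding subsystem_def partial_triple_system_def by auto
qed

lemma subsystem_line_closed:
  assumes "subsystem Q M P L"
  shows "line_closed L Q"
  unfolding line_closed_def
proof (intro allI impI)
  fix p q r assume l: "{p, q, r} \<in> L" "p \<in> Q" "q \<in> Q"
  have "card {p, q} \<le> card ({p, q, r} \<inter> Q)" using l by (intro card_mono) auto
  then have "{p, q, r} \<in> M"
    using l line_distinct[OF l(1)] assms unfolding subsystem_def by auto
  then show "r \<in> Q" using assms unfolding subsystem_def partial_triple_system_def by auto
qed

text \<open>A subsystem is determined by its point set: its lines lie inside \<open>Q\<close>, and a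
  line inside \<open>Q\<close> meets it in three points and must be kept. From here on subsystems
  are handled as line-closed sets.\<close>

lemma subsystem_lines:
  assumes "subsystem Q M P L"
  shows "M = {l \<in> L. l \<subseteq> Q}"
proof
  show "M \<subseteq> {l \<in> L. l \<subseteq> Q}" using assms unfolding subsystem_def partial_triple_system_def by auto
  have "card (l \<inter> Q) \<ge> 2" if "l \<in> L" "l \<subseteq> Q" for l
    using that line_card[of l] by (simp add: Int_absorb2)
  then show "{l \<in> L. l \<subseteq> Q} \<subseteq> M" using assms unfolding subsystem_def by auto
qed

text \<open>Minimality among subsystems becomes an induction principle: a closed set of points
  containing the generators is everything. Rank arguments go through this form.\<close>

lemma generates_iff:
  "generated_subsystem P L S P L \<longleftrightarrow>
     S \<subseteq> P \<and> (\<forall>Q\<subseteq>P. line_closed L Q \<longrightarrow> S \<subseteq> Q \<longrightarrow> Q = P)" (is "?l \<longleftrightarrow> ?r")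
proof
  assume l: ?l
  then show ?r
    unfolding generated_subsystem_def using line_closed_subsystem by (metis subset_antisym)
next
  assume r: ?r
  have "line_closed L P" by (auto simp: line_closed_def dest: line_points)
  moreover have "{l \<in> L. 2 \<le> card (l \<inter> P)} = L"
    using line_subset line_card by (auto simp: Int_absorb2)
  ultimately have "subsystem P L P L" using line_closed_subsystem[of P] by auto
  moreover have "P \<subseteq> Q \<and> L \<subseteq> M" if "subsystem Q M P L" "S \<subseteq> Q" for Q M
  proof -
    have "Q \<subseteq> P" using that unfolding subsystem_def by auto
    then have "Q = P" using r subsystem_line_closed that by auto
    then show ?thesis using subsystem_lines[OF that(1)] line_subset by auto
  qed
  ultimately show ?l using r unfolding generated_subsystem_def by auto
qed

lemma exists_generated_subsystem:
  assumes "S \<subseteq> P"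
  obtains Q where "generated_subsystem P L S Q {l \<in> L. l \<subseteq> Q}" "line_closed L Q" "S \<subseteq> Q" "Q \<subseteq> P"
proof -
  define Q where "Q = \<Inter> {R. R \<subseteq> P \<and> line_closed L R \<and> S \<subseteq> R}"
  have "line_closed L P" by (auto simp: line_closed_def dest: line_points)
  then have sub: "Q \<subseteq> P" "S \<subseteq> Q" using assms unfolding Q_def by auto
  have cl: "line_closed L Q" unfolding Q_def by (auto simp: line_closed_def)
  have s: "subsystem Q {l \<in> L. l \<subseteq> Q} P L"
    using line_closed_subsystem[OF cl sub(1)] subsystem_lines by metis
  have "Q \<subseteq> R \<and> {l \<in> L. l \<subseteq> Q} \<subseteq> M" if "subsystem R M P L" "S \<subseteq> R" for R M
  proof -
    have "R \<subseteq> P" "line_closed L R" using that subsystem_line_closed unfolding subsystem_def by auto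
    then have "Q \<subseteq> R" using that unfolding Q_def by auto
    then show ?thesis using subsystem_lines[OF that(1)] by auto
  qed
  then have "generated_subsystem P L S Q {l \<in> L. l \<subseteq> Q}"
    using s sub unfolding generated_subsystem_def by auto
  then show ?thesis using that cl sub by blast
qed

end

lemma isomorphic_systemsI:
  assumes bij: "bij_betw f P P'" and lines: "(\<lambda>l. f ` l) ` L = L'" and sub: "L \<subseteq> Pow P"
  shows "isomorphic_systems P L P' L'"
proof -
  have "inj_on (\<lambda>l. f ` l) (Pow P)"
    using bij by (simp add: bij_betw_def inj_on_image_Pow)
  then have "bij_betw (\<lambda>l. f ` l) L L'"
    using lines sub unfolding bij_betw_def by (meson inj_on_subset)
  then show ?thesis using bij unfolding isomorphic_systems_def by blast
qed

lemma isomorphic_systems_sym: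
  assumes "isomorphic_systems P L P' L'" and sub: "L \<subseteq> Pow P"
  shows "isomorphic_systems P' L' P L"
proof -
  obtain f where f: "bij_betw f P P'" "bij_betw (\<lambda>l. f ` l) L L'"
    using assms unfolding isomorphic_systems_def by blast
  let ?g = "the_inv_into P f"
  have g: "bij_betw ?g P' P" using f(1) by (rule bij_betw_the_inv_into)
  have inv: "?g ` f ` l = l" if "l \<in> L" for l
  proof -
    have "?g ` f ` l = (\<lambda>x. ?g (f x)) ` l" by (simp add: image_image)
    also have "\<dots> = (\<lambda>x. x) ` l"
      using f(1) that sub by (intro image_cong) (auto simp: bij_betw_def the_inv_into_f_f subset_iff)
    finally show ?thesis by simp
  qed
  have L': "L' = (\<lambda>l. f ` l) ` L" using f(2) by (simp add: bij_betw_def)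
  have "(\<lambda>l. ?g ` l) ` L' = (\<lambda>l. ?g ` f ` l) ` L" unfolding L' by (simp only: image_image)
  also have "\<dots> = L" using inv by simp
  finally have "(\<lambda>l. ?g ` l) ` L' = L" .
  moreover have "L' \<subseteq> Pow P'" unfolding L' using f(1) sub by (fastforce simp: bij_betw_def)
  ultimately show ?thesis using isomorphic_systemsI[OF g] by blast
qed

lemma isomorphic_systemsE:
  assumes "isomorphic_systems P L P' L'" and sub: "L \<subseteq> Pow P"
  obtains f where "bij_betw f P P'"
    "\<And>p q r. p \<in> P \<Longrightarrow> q \<in> P \<Longrightarrow> r \<in> P \<Longrightarrow> {f p, f q, f r} \<in> L' \<longleftrightarrow> {p, q, r} \<in> L"
    "L' = (\<lambda>l. f ` l) ` L"
proof -
  obtain f where f: "bij_betw f P P'" "bij_betw (\<lambda>l. f ` l) L L'"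
    using assms unfolding isomorphic_systems_def by blast
  have L': "L' = (\<lambda>l. f ` l) ` L" using f(2) by (simp add: bij_betw_def)
  have inj: "inj_on f P" using f(1) by (simp add: bij_betw_def)
  have "{f p, f q, f r} \<in> L' \<longleftrightarrow> {p, q, r} \<in> L" if "p \<in> P" "q \<in> P" "r \<in> P" for p q r
  proof
    assume "{f p, f q, f r} \<in> L'"
    then obtain l where l: "l \<in> L" "f ` {p, q, r} = f ` l" unfolding L' by auto
    then have "{p, q, r} = l"
      using that sub inj by (intro inj_on_image_eq_iff[OF inj, THEN iffD1]) auto
    then show "{p, q, r} \<in> L" using l by simp
  next
    assume "{p, q, r} \<in> L"
    then have "f ` {p, q, r} \<in> L'" unfolding L' by (rule imageI)
    then show "{f p, f q, f r} \<in> L'" by simp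
  qed
  then show ?thesis using that f(1) L' by blast
qed

lemma connected_systemD:
  assumes "connected_system P L"
  shows "P \<noteq> {}" "p \<in> P \<Longrightarrow> q \<in> P \<Longrightarrow> equivclp (collinear L) p q"
proof -
  let ?R = "{(p, q). p \<in> P \<and> q \<in> P \<and> equivclp (collinear L) p q}"
  obtain X where X: "P // ?R = {X}"
    using assms unfolding connected_system_def by (rule card_1_singletonE)
  then show "P \<noteq> {}" by (auto simp: quotient_def)
  assume pq: "p \<in> P" "q \<in> P"
  then have "?R `` {p} \<in> P // ?R" "?R `` {q} \<in> P // ?R" using pq by (auto intro!: quotientI simp del: Image_Collect_case_prod)
  then have "?R `` {p} = ?R `` {q}" using X by auto
  moreover have "q \<in> ?R `` {q}" using pq by auto
  ultimately have "q \<in> ?R `` {p}" by simp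
  then show "equivclp (collinear L) p q" by simp
qed

lemma connected_system_induct:
  assumes "connected_system P L" and "p \<in> P" "p \<in> Q"
    and step: "\<And>x y. x \<in> Q \<Longrightarrow> collinear L x y \<Longrightarrow> y \<in> Q" and "q \<in> P"
  shows "q \<in> Q"
proof -
  have "equivclp (collinear L) p q" using connected_systemD assms by metis
  then show ?thesis
  proof (induction rule: equivclp_induct)
    case base
    then show ?case using assms by simp
  next
    case (step y z)
    \<comment> \<open>The equivalence closure also steps backwards; symmetry of collinearity turns
      such a step into one of the assumed form.\<close>
    then show ?case using assms(4) unfolding collinear_def by metis
  qed
qed

section \<open>Matsuo algebras\<close>

lemma lookup_pm_scale [simp]: "Poly_Mapping.lookup (pm_scale c x) k = c * Poly_Mapping.lookup x k"
  unfolding pm_scale_def by (simp add: map.rep_eq when_def)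

lemma lookup_axis: "Poly_Mapping.lookup (axis p) q = (if p = q then 1 else 0)"
  unfolding axis_def by (simp add: lookup_single when_def)

lemma pm_scale_one [simp]: "pm_scale 1 x = x"
  by (rule poly_mapping_eqI) simp

lemma vector_space_pm_scale: "vector_space (pm_scale :: 'f::field \<Rightarrow> ('a \<Rightarrow>\<^sub>0 'f) \<Rightarrow> _)"
  by unfold_locales (auto intro!: poly_mapping_eqI simp: lookup_add algebra_simps)

text \<open>The supports in the definition vary with the arguments; fixed finite index sets make
  linearity a termwise matter.\<close>

lemma matsuo_mult_superset:
  assumes "finite A" "finite B" "Poly_Mapping.keys x \<subseteq> A" "Poly_Mapping.keys y \<subseteq> B"
  shows "matsuo_mult L \<delta> x y =
    (\<Sum>p\<in>A. \<Sum>q\<in>B. pm_scale (Poly_Mapping.lookup x p * Poly_Mapping.lookup y q) (axis_mult L \<delta> p q))"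
proof -
  have z: "pm_scale 0 v = 0" for v :: "'a \<Rightarrow>\<^sub>0 'b" by (rule poly_mapping_eqI) simp
  have "(\<Sum>q\<in>Poly_Mapping.keys y. pm_scale (Poly_Mapping.lookup x p * Poly_Mapping.lookup y q) (axis_mult L \<delta> p q))
      = (\<Sum>q\<in>B. pm_scale (Poly_Mapping.lookup x p * Poly_Mapping.lookup y q) (axis_mult L \<delta> p q))" for p
    using assms by (intro sum.mono_neutral_left) (auto simp: not_in_keys_iff_lookup_eq_zero z)
  then show ?thesis unfolding matsuo_mult_def
    using assms by (simp, intro sum.mono_neutral_left) (auto simp: not_in_keys_iff_lookup_eq_zero z)
qed

lemma pm_scale_add_left: "pm_scale (a + b) x = pm_scale a x + pm_scale b x"
  by (rule poly_mapping_eqI) (simp add: lookup_add algebra_simps)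

lemma pm_scale_pm_scale: "pm_scale a (pm_scale b x) = pm_scale (a * b) x"
  by (rule poly_mapping_eqI) (simp add: algebra_simps)

lemma pm_scale_sum: "pm_scale a (sum f A) = (\<Sum>x\<in>A. pm_scale a (f x))"
  by (rule poly_mapping_eqI) (simp add: lookup_sum sum_distrib_left)

lemma matsuo_mult_commute: "matsuo_mult L \<delta> x y = matsuo_mult L \<delta> y x"
proof -
  have "axis_mult L \<delta> p q = axis_mult L \<delta> q p" for p q
    by (auto simp: axis_mult_def collinear_def third_point_def insert_commute add.commute conj_commute)
  then show ?thesis unfolding matsuo_mult_def by (subst sum.swap) (simp add: mult.commute)
qed

lemma matsuo_mult_add_left: "matsuo_mult L \<delta> (x + y) z = matsuo_mult L \<delta> x z + matsuo_mult L \<delta> y z"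
proof -
  let ?A = "Poly_Mapping.keys x \<union> Poly_Mapping.keys y"
  have s: "finite ?A" "Poly_Mapping.keys (x + y) \<subseteq> ?A" using keys_add[of x y] by auto
  show ?thesis
    by (subst (1 2 3) matsuo_mult_superset[where A = ?A and B = "Poly_Mapping.keys z"])
      (use s in \<open>auto simp: lookup_add distrib_right pm_scale_add_left sum.distrib\<close>)
qed

lemma matsuo_mult_scale_left: "matsuo_mult L \<delta> (pm_scale c x) y = pm_scale c (matsuo_mult L \<delta> x y)"
proof -
  have "Poly_Mapping.keys (pm_scale c x) \<subseteq> Poly_Mapping.keys x"
    by (auto simp: in_keys_iff)
  then show ?thesis
    by (subst (1 2) matsuo_mult_superset[where A = "Poly_Mapping.keys x" and B = "Poly_Mapping.keys y"])
      (auto simp: pm_scale_sum pm_scale_pm_scale mult.assoc)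
qed

lemma matsuo_mult_add_right: "matsuo_mult L \<delta> z (x + y) = matsuo_mult L \<delta> z x + matsuo_mult L \<delta> z y"
  using matsuo_mult_add_left matsuo_mult_commute by metis

lemma matsuo_mult_scale_right: "matsuo_mult L \<delta> x (pm_scale c y) = pm_scale c (matsuo_mult L \<delta> x y)"
  using matsuo_mult_scale_left matsuo_mult_commute by metis

lemma matsuo_mult_zero_left [simp]: "matsuo_mult L \<delta> 0 z = 0"
  and matsuo_mult_zero_right [simp]: "matsuo_mult L \<delta> z 0 = 0"
  unfolding matsuo_mult_def by simp_all

lemma matsuo_mult_minus_left: "matsuo_mult L \<delta> (- x) z = - matsuo_mult L \<delta> x z"
  by (metis add.left_inverse eq_neg_iff_add_eq_0 matsuo_mult_add_left matsuo_mult_zero_left)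

lemma matsuo_mult_diff_left: "matsuo_mult L \<delta> (x - y) z = matsuo_mult L \<delta> x z - matsuo_mult L \<delta> y z"
  by (metis add_uminus_conv_diff matsuo_mult_add_left matsuo_mult_minus_left)

lemma matsuo_mult_diff_right: "matsuo_mult L \<delta> z (x - y) = matsuo_mult L \<delta> z x - matsuo_mult L \<delta> z y"
  using matsuo_mult_diff_left matsuo_mult_commute by metis

lemmas matsuo_mult_bilinear =
  matsuo_mult_add_left matsuo_mult_add_right matsuo_mult_diff_left matsuo_mult_diff_right

lemma matsuo_mult_axis: "matsuo_mult L \<delta> (axis p) (axis q) = axis_mult L \<delta> p q"
  unfolding matsuo_mult_def by (simp add: axis_def)

lemma axis_in_carrier: "p \<in> P \<Longrightarrow> axis p \<in> matsuo_carrier P"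
  by (simp add: axis_def matsuo_carrier_def)

lemma subspace_matsuo_carrier: "module.subspace pm_scale (matsuo_carrier P :: ('a \<Rightarrow>\<^sub>0 'f::field) set)"
proof -
  interpret vector_space "pm_scale :: 'f \<Rightarrow> ('a \<Rightarrow>\<^sub>0 'f) \<Rightarrow> _" by (rule vector_space_pm_scale)
  have "Poly_Mapping.keys (x + y) \<subseteq> P"
    if "Poly_Mapping.keys x \<subseteq> P" "Poly_Mapping.keys y \<subseteq> P" for x y :: "'a \<Rightarrow>\<^sub>0 'f"
    using that keys_add[of x y] by blast
  moreover have "Poly_Mapping.keys (pm_scale c x) \<subseteq> P" if "Poly_Mapping.keys x \<subseteq> P" for c :: 'f and x
    using that by (auto simp: in_keys_iff)
  ultimately show ?thesis unfolding subspace_def matsuo_carrier_def by auto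
qed

context pts
begin

lemma axis_mult_in_carrier:
  assumes "p \<in> P" "q \<in> P"
  shows "(axis_mult L \<delta> p q :: 'a \<Rightarrow>\<^sub>0 'f::field) \<in> matsuo_carrier P"
proof -
  interpret vector_space "pm_scale :: 'f \<Rightarrow> ('a \<Rightarrow>\<^sub>0 'f) \<Rightarrow> _" by (rule vector_space_pm_scale)
  have "col p q \<Longrightarrow> third p q \<in> P" using third_line line_points by metis
  then show ?thesis unfolding axis_mult_def using assms
    by (auto intro!: subspace_scale subspace_diff subspace_add subspace_0 subspace_matsuo_carrier axis_in_carrier)
qed

lemma matsuo_mult_in_carrier:
  fixes x y :: "'a \<Rightarrow>\<^sub>0 'f::field"
  assumes "x \<in> matsuo_carrier P" "y \<in> matsuo_carrier P"
  shows "matsuo_mult L \<delta> x y \<in> matsuo_carrier P"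
proof -
  interpret vector_space "pm_scale :: 'f \<Rightarrow> ('a \<Rightarrow>\<^sub>0 'f) \<Rightarrow> _" by (rule vector_space_pm_scale)
  show ?thesis unfolding matsuo_mult_def
    using assms by (intro subspace_sum subspace_scale subspace_matsuo_carrier axis_mult_in_carrier)
      (auto simp: matsuo_carrier_def)
qed

lemma matsuo_jordan_iff:
  "jordan_algebra pm_scale (matsuo_carrier P) (matsuo_mult L (\<delta> :: 'f::field)) \<longleftrightarrow>
    (\<forall>a\<in>matsuo_carrier P. \<forall>b\<in>matsuo_carrier P.
       matsuo_mult L \<delta> (matsuo_mult L \<delta> (matsuo_mult L \<delta> a a) b) a =
       matsuo_mult L \<delta> (matsuo_mult L \<delta> a a) (matsuo_mult L \<delta> b a))"
proof -
  have "algebra_on pm_scale (matsuo_carrier P) (matsuo_mult L \<delta>)"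
    unfolding algebra_on_def
    using vector_space_pm_scale subspace_matsuo_carrier matsuo_mult_in_carrier
    by (auto simp: matsuo_mult_bilinear matsuo_mult_scale_left matsuo_mult_scale_right)
  then show ?thesis unfolding jordan_algebra_def using matsuo_mult_commute by blast
qed

end

section \<open>Consequences of the Jordan identity\<close>

text \<open>The identity has degree three in \<open>a\<close>, so inclusion-exclusion over the
  nonempty subsets of \<open>{x, y, z}\<close> isolates the part linear in each variable.
  Commutativity identifies the six orderings in pairs, which doubles both sides; in an abelian group
  the factor cannot simply be cancelled.\<close>

lemma jordan_polarization:
  fixes M :: "'v::ab_group_add \<Rightarrow> 'v \<Rightarrow> 'v"
  assumes add_left: "\<And>x y z. M (x + y) z = M x z + M y z"
    and commute: "\<And>x y. M x y = M y x"
    and jordan: "\<And>a. a \<in> A \<Longrightarrow> M (M (M a a) b) a = M (M a a) (M b a)"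
    and closed: "\<And>x y. x \<in> A \<Longrightarrow> y \<in> A \<Longrightarrow> x + y \<in> A"
    and mem: "x \<in> A" "y \<in> A" "z \<in> A"
  shows "(M z (M (M x y) b) + M x (M (M y z) b) + M y (M (M z x) b)) +
      (M z (M (M x y) b) + M x (M (M y z) b) + M y (M (M z x) b)) =
    (M (M x y) (M z b) + M (M y z) (M x b) + M (M z x) (M y b)) +
      (M (M x y) (M z b) + M (M y z) (M x b) + M (M z x) (M y b))" (is "?S + ?S = ?S' + ?S'")
proof -
  define J where "J a = M (M (M a a) b) a - M (M a a) (M b a)" for a
  have add_right: "M z (x + y) = M z x + M z y" for x y z
    by (metis add_left commute)
  have "J (x + y + z) - J (x + y) - J (y + z) - J (x + z) + J x + J y + J z = ?S + ?S - (?S' + ?S')"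
    unfolding J_def add_left add_right commute[of y x] commute[of z y] commute[of x z]
      commute[of x b] commute[of y b] commute[of z b] commute[of x "M _ b"] commute[of y "M _ b"] commute[of z "M _ b"]
    by (simp add: algebra_simps)
  moreover have "J a = 0" if "a \<in> A" for a using jordan[OF that] unfolding J_def by simp
  ultimately show ?thesis using mem closed by simp
qed

locale jordan_matsuo = pts P L for P :: "'a set" and L +
  fixes \<delta> :: "'f::field"
  assumes char: "CHAR('f) = 3" and delta: "\<delta> = 1 / 4"
    and jordan: "jordan_algebra pm_scale (matsuo_carrier P) (matsuo_mult L \<delta>)"

lemma char3: "CHAR('f::field) = 3 \<Longrightarrow> (3::'f) = 0"
  by (metis of_nat_CHAR of_nat_numeral)

lemma char3_two:
  assumes "CHAR('f::field) = 3"
  shows "(2::'f) = -1"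
proof -
  have "(2::'f) = 3 - 1" by simp
  then show ?thesis using char3[OF assms] by simp
qed

lemma char3_quarter:
  assumes "CHAR('f::field) = 3"
  shows "(1 / 4 :: 'f) = 1"
proof -
  have "(4::'f) = 3 + 1" by simp
  also have "\<dots> = 1" using char3[OF assms] by (simp del: numeral_plus_one)
  finally show ?thesis by simp
qed

lemma (in pts) axis_products:
  shows axis_self: "matsuo_mult L 1 (axis p) (axis p) = axis p"
    and axis_line: "{p, q, r} \<in> L \<Longrightarrow> matsuo_mult L 1 (axis p) (axis q) = axis p + axis q - axis r"
    and axis_noncol: "p \<noteq> q \<Longrightarrow> \<not> col p q \<Longrightarrow> matsuo_mult L \<delta> (axis p) (axis q) = 0"
  using line_distinct[of p q r] line_col[of p q r] third_eq[of p q r]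
  by (auto simp: matsuo_mult_axis axis_mult_def)

context jordan_matsuo
begin

lemma delta_one: "\<delta> = 1"
  using delta char3_quarter[OF char] by simp

abbreviation prod (infixl "\<bullet>" 70) where "prod \<equiv> matsuo_mult L \<delta>"

abbreviation ax :: "'a \<Rightarrow> ('a \<Rightarrow>\<^sub>0 'f)" where "ax \<equiv> axis"

abbreviation cf :: "('a \<Rightarrow>\<^sub>0 'f) \<Rightarrow> 'a \<Rightarrow> 'f" where "cf \<equiv> Poly_Mapping.lookup"

lemma ax_self: "ax p \<bullet> ax p = ax p"
  and ax_line: "{p, q, r} \<in> L \<Longrightarrow> ax p \<bullet> ax q = ax p + ax q - ax r"
  and ax_noncol: "p \<noteq> q \<Longrightarrow> \<not> col p q \<Longrightarrow> ax p \<bullet> ax q = 0"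
  unfolding delta_one by (rule axis_products; assumption)+

lemma polarized_jordan:
  assumes "p \<in> P" "q \<in> P" "s \<in> P" "t \<in> P"
  shows "ax s \<bullet> (ax p \<bullet> ax q \<bullet> ax t) + ax p \<bullet> (ax q \<bullet> ax s \<bullet> ax t) + ax q \<bullet> (ax s \<bullet> ax p \<bullet> ax t) =
    ax p \<bullet> ax q \<bullet> (ax s \<bullet> ax t) + ax q \<bullet> ax s \<bullet> (ax p \<bullet> ax t) + ax s \<bullet> ax p \<bullet> (ax q \<bullet> ax t)"
    (is "?S = ?S'")
proof -
  interpret vector_space "pm_scale :: 'f \<Rightarrow> ('a \<Rightarrow>\<^sub>0 'f) \<Rightarrow> _" by (rule vector_space_pm_scale)
  note J = jordan[unfolded matsuo_jordan_iff]
  have double: "?S + ?S = ?S' + ?S'"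
    by (rule jordan_polarization[where M = "(\<bullet>)" and A = "matsuo_carrier P"])
      (use J assms in \<open>auto simp: matsuo_mult_add_left axis_in_carrier
         intro: matsuo_mult_commute subspace_add[OF subspace_matsuo_carrier]\<close>)
  show ?thesis
  proof (rule poly_mapping_eqI)
    fix k
    have "cf ?S k + cf ?S k = cf ?S' k + cf ?S' k" using double by (metis lookup_add)
    then have "2 * (cf ?S k - cf ?S' k) = 0" by (simp only: mult_2 right_diff_distrib diff_self)
    \<comment> \<open>Coefficients lie in a field where 2 = -1, so the doubling left by the
      polarization cancels.\<close>
    moreover have "(2::'f) \<noteq> 0" using char3_two[OF char] by (metis neg_equal_0_iff_equal zero_neq_one)
    ultimately show "cf ?S k = cf ?S' k" by simp
  qed
qed


section \<open>Coefficients on a closed set of points that does not contain \<open>t\<close>\<close>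

lemma cf_ax_prod_outside:
  assumes "line_closed L Q" "a \<in> Q" "w \<notin> Q" "y \<in> Q" "y \<noteq> a"
  shows "cf (ax a \<bullet> ax w) y = 0"
proof (cases "col a w")
  case True
  then have l: "{a, w, third a w} \<in> L" by (rule third_line)
  then have "third a w \<notin> Q" using line_closedD[OF assms(1), of a "third a w" w] assms by (auto simp: insert_commute)
  then show ?thesis using ax_line[OF l] assms by (auto simp: lookup_add lookup_minus lookup_axis)
next
  case False
  moreover have "a \<noteq> w" using assms by blast
  ultimately show ?thesis by (simp add: ax_noncol)
qed

text \<open>If \<open>b\<close> and \<open>t\<close> are collinear, then
  \<open>ax b \<bullet> ax t\<close> is \<open>ax b\<close> plus axes of points outside
  \<open>Q\<close>, and by \<open>cf_ax_prod_outside\<close> the latter contribute nothing at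
  \<open>y\<close>. So \<open>t\<close> acts on \<open>b\<close> as the scalar 1 or 0, which turns
  the polarized identity into a relation between indicators of collinearity.\<close>

lemma cf_ax_prod_prod:
  assumes "line_closed L Q" "t \<notin> Q" "a \<in> Q" "b \<in> Q" "y \<in> Q" "y \<noteq> a"
  shows "cf (ax a \<bullet> (ax b \<bullet> ax t)) y = of_bool (col b t) * cf (ax a \<bullet> ax b) y"
proof (cases "col b t")
  case True
  then have l: "{b, t, third b t} \<in> L" by (rule third_line)
  then have "third b t \<notin> Q" using line_closedD[OF assms(1), of b "third b t" t] assms by (auto simp: insert_commute)
  then show ?thesis using True ax_line[OF l] assms
    by (simp add: matsuo_mult_bilinear lookup_add lookup_minus cf_ax_prod_outside[OF assms(1)])
next
  case False
  moreover have "b \<noteq> t" using assms by blast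
  ultimately show ?thesis by (simp add: ax_noncol)
qed

lemma cf_ax_prod_line: "{a, b, c} \<in> L \<Longrightarrow> cf (ax a \<bullet> ax b) y =
    of_bool (y = a) + of_bool (y = b) - of_bool (y = c)"
  by (auto simp: ax_line lookup_add lookup_minus lookup_axis)

text \<open>The coefficient of \<open>z\<close> in the polarized identity for \<open>p\<close>, \<open>q\<close>, \<open>x\<close> acting on \<open>t\<close>.\<close>

lemma affine_configuration:
  assumes Q: "line_closed L Q" and t: "t \<notin> Q" "t \<in> P"
    and mem: "x \<in> Q" "y \<in> Q" "p \<in> Q"
    and lines: "{x, y, z} \<in> L" "{p, q, y} \<in> L" "{q, x, w} \<in> L" "{x, p, v} \<in> L"
      "{w, p, w'} \<in> L" "{v, q, v'} \<in> L"
    and ne: "p \<noteq> z" "w' \<noteq> z" "v' \<noteq> z"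
  shows "col x t \<longleftrightarrow> col y t"
proof -
  let ?\<chi> = "\<lambda>a. of_bool (col a t) :: 'f"
  have "z \<in> Q" "q \<in> Q" using lines line_closedD[OF Q] mem by (metis insert_commute)+
  then have mem': "z \<in> Q" "q \<in> Q" "w \<in> Q" "v \<in> Q" using lines line_closedD[OF Q] mem by blast+
  have ne': "z \<noteq> x" "z \<noteq> y" "p \<noteq> x" "p \<noteq> y" "q \<noteq> y"
    using lines line_distinct by metis+
  have "q \<noteq> z" using lines(1,2) ne' line_unique[of y z p x] by (metis insert_commute)
  moreover have "w \<noteq> z" using lines(1,3) ne' line_unique[of x z q y] by (metis insert_commute)
  moreover have "v \<noteq> z" using lines(1,4) ne' line_unique[of x z p y] by (metis insert_commute)
  ultimately have ne'': "q \<noteq> z" "w \<noteq> z" "v \<noteq> z" .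
  have perm: "{y, x, z} \<in> L" "{p, x, v} \<in> L" "{x, q, w} \<in> L" "{x, y, z} \<in> L" "{q, p, y} \<in> L"
     "{p, w, w'} \<in> L" "{q, v, v'} \<in> L"
    using lines by (auto simp: insert_commute)
  note prods = lines(2-4)[THEN ax_line]
  note cfs = lines[THEN cf_ax_prod_line, of z] perm[THEN cf_ax_prod_line, of z]
  \<comment> \<open>Only the product of \<open>ax x\<close> and \<open>ax y\<close> reaches
    \<open>z\<close>. On the left it comes from the summand \<open>- ax y\<close> of
    \<open>ax p \<bullet> ax q\<close>, weighted by the indicator of \<open>y\<close>; on the right
    it meets \<open>ax x \<bullet> ax t\<close> and is weighted by that of \<open>x\<close>. The
    inequalities with \<open>z\<close> remove all other contributions.\<close>
  have "cf (ax x \<bullet> (ax p \<bullet> ax q \<bullet> ax t) + ax p \<bullet> (ax q \<bullet> ax x \<bullet> ax t) + ax q \<bullet> (ax x \<bullet> ax p \<bullet> ax t)) z =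
    cf (ax p \<bullet> ax q \<bullet> (ax x \<bullet> ax t) + ax q \<bullet> ax x \<bullet> (ax p \<bullet> ax t) + ax x \<bullet> ax p \<bullet> (ax q \<bullet> ax t)) z"
    using polarized_jordan[of p q x t] lines(1,2) line_points t(2) by metis
  then have "?\<chi> y = ?\<chi> x"
    using ne ne' ne'' mem mem' ne[symmetric] ne'[symmetric] ne''[symmetric]
    by (simp add: prods matsuo_mult_bilinear lookup_add lookup_minus cf_ax_prod_prod[OF Q t(1)] cfs)
  then show ?thesis by (auto simp: of_bool_def split: if_splits)
qed

text \<open>The points of a dual affine plane correspond to the edges of the complete graph on four vertices,
  its lines to the triangles. The claim is the coefficient of \<open>e14\<close> in the polarized identity for
  \<open>e12\<close>, \<open>e23\<close>, \<open>e34\<close> acting on \<open>t\<close>.\<close>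

lemma dual_affine_balance:
  assumes Q: "line_closed L Q" and t: "t \<notin> Q" "t \<in> P"
    and mem: "e12 \<in> Q" "e13 \<in> Q" "e14 \<in> Q" "e23 \<in> Q" "e24 \<in> Q" "e34 \<in> Q"
    and lines: "{e12, e13, e23} \<in> L" "{e12, e14, e24} \<in> L" "{e13, e14, e34} \<in> L" "{e23, e24, e34} \<in> L"
    and nc: "\<not> col e12 e34" and dist: "distinct [e12, e13, e14, e23, e24, e34]"
  shows "(of_bool (col e12 t) + of_bool (col e34 t) :: nat) = of_bool (col e13 t) + of_bool (col e24 t)"
proof -
  let ?\<chi> = "\<lambda>a. of_bool (col a t) :: 'f"
  have perm: "{e12, e23, e13} \<in> L" "{e23, e34, e24} \<in> L" "{e34, e23, e24} \<in> L" "{e23, e12, e13} \<in> L"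
    "{e34, e13, e14} \<in> L" "{e13, e34, e14} \<in> L" "{e12, e24, e14} \<in> L" "{e24, e12, e14} \<in> L"
    using lines by (auto simp: insert_commute)
  have zero: "ax e34 \<bullet> ax e12 = 0" "ax e12 \<bullet> ax e34 = 0"
    using ax_noncol[of e12 e34] ax_noncol[of e34 e12] nc dist col_sym by auto
  note cfs = perm[THEN cf_ax_prod_line, of e14]
  have "cf (ax e34 \<bullet> (ax e12 \<bullet> ax e23 \<bullet> ax t) + ax e12 \<bullet> (ax e23 \<bullet> ax e34 \<bullet> ax t)
        + ax e23 \<bullet> (ax e34 \<bullet> ax e12 \<bullet> ax t)) e14 =
    cf (ax e12 \<bullet> ax e23 \<bullet> (ax e34 \<bullet> ax t) + ax e23 \<bullet> ax e34 \<bullet> (ax e12 \<bullet> ax t)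
        + ax e34 \<bullet> ax e12 \<bullet> (ax e23 \<bullet> ax t)) e14"
    using polarized_jordan[of e12 e23 e34 t] lines line_points t(2) by metis
  then have eq: "?\<chi> e13 + ?\<chi> e24 = ?\<chi> e34 + ?\<chi> e12"
    using dist mem not_sym[of e12 e14] not_sym[of e13 e14]
      not_sym[of e14 e23] not_sym[of e14 e24] not_sym[of e14 e34]
    by (simp add: add_ac lookup_axis zero perm(1,2)[THEN ax_line] matsuo_mult_bilinear lookup_add lookup_minus
        cf_ax_prod_prod[OF Q t(1)] cfs)
  \<comment> \<open>Each side is a sum of two indicators, with value 0, 1 or 2. These stay distinct
    in the field, so the equation holds between natural numbers.\<close>
  have "(2::'f) \<noteq> 1"
  proof
    assume "(2::'f) = 1"
    then have "(1::'f) + 1 = 0 + 1" by simp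
    then show False unfolding add_right_cancel by simp
  qed
  moreover have "(2::'f) \<noteq> 0" using char3_two[OF char] by (metis neg_equal_0_iff_equal zero_neq_one)
  ultimately have two: "(2::'f) \<noteq> 0" "(1::'f) \<noteq> 2" by auto
  show ?thesis using eq two by (auto simp: of_bool_def split: if_splits)
qed

end

section \<open>Planes of Fischer spaces\<close>

text \<open>The label \<open>x\<close> goes to the one point of \<open>l\<close> not collinear with
  \<open>t\<close>; \<open>u\<close> and \<open>v\<close> are the third points on the lines joining
  \<open>t\<close> to the other two.\<close>

lemma dual_affine_labelling:
  assumes "l \<in> dual_affine_lines" "t \<in> dual_affine_points - l"
  obtains x y z u v where "l = {x, y, z}" "{t, y, u} \<in> dual_affine_lines" "{t, z, v} \<in> dual_affine_lines"
    "{x, u, v} \<in> dual_affine_lines" "distinct [x, y, z, t, u, v]" "dual_affine_points = {x, y, z, t, u, v}"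
proof -
  \<comment> \<open>Stated for all lines and points at once, this is a closed formula with
    quantifiers over finite sets, decided by evaluation.\<close>
  have "\<forall>l\<in>dual_affine_lines. \<forall>t\<in>dual_affine_points - l.
    \<exists>x\<in>l. \<exists>y\<in>l. \<exists>z\<in>l. l = {x, y, z} \<and> (\<exists>u\<in>dual_affine_points. \<exists>v\<in>dual_affine_points.
      {t, y, u} \<in> dual_affine_lines \<and> {t, z, v} \<in> dual_affine_lines \<and> {x, u, v} \<in> dual_affine_lines \<and>
      distinct [x, y, z, t, u, v] \<and> dual_affine_points = {x, y, z, t, u, v})"
    unfolding dual_affine_points_def dual_affine_lines_def by code_simp
  from bspec[OF bspec[OF this assms(1)] assms(2)] show thesis using that by metis
qed

lemma three_torsion: "(a::3) + a = - a"
proof -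
  have "(1::3) + 1 = -1" by simp
  then have "a * (1 + 1) = a * (-1)" by (rule arg_cong)
  then show ?thesis by (simp add: distrib_left del: one_add_one)
qed

lemma three_torsion_fun: "(a :: nat \<Rightarrow> 3) + a = - a"
  by (rule ext) (simp only: plus_fun_apply uminus_apply three_torsion)

text \<open>Four vectors with entries 0 and 1 outnumber any three points; this supplies points off a
  given line.\<close>

lemma affine_points_not_subset_3:
  fixes a b c :: "nat \<Rightarrow> 3"
  shows "\<exists>w\<in>affine_points 2. w \<notin> {a, b, c}"
proof (rule ccontr)
  assume "\<not> ?thesis"
  then have sub: "affine_points 2 \<subseteq> {a, b, c}" by blast
  define F where "F i j = (\<lambda>k::nat. if k = 0 then i else if k = 1 then j else (0::3))" for i j
  have "F i j \<in> affine_points 2" for i j by (auto simp: F_def affine_points_def)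
  then have "{F 0 0, F 0 1, F 1 0, F 1 1} \<subseteq> {a, b, c}" using sub by auto
  then have "card {F 0 0, F 0 1, F 1 0, F 1 1} \<le> card {a, b, c}" by (intro card_mono) auto
  also have "\<dots> \<le> 3" by (auto simp: card_insert_if)
  finally have "card {F 0 0, F 0 1, F 1 0, F 1 1} \<le> 3" .
  moreover have "F i j = F i' j' \<longleftrightarrow> i = i' \<and> j = j'" for i j i' j'
  proof
    assume "F i j = F i' j'"
    then have "F i j 0 = F i' j' 0" "F i j 1 = F i' j' 1" by simp_all
    then show "i = i' \<and> j = j'" by (simp add: F_def)
  qed simp
  ultimately show False by simp
qed

context pts
begin

text \<open>Only the point set is recorded, since it determines the lines; closedness stands in for
  being generated by two lines.\<close>

definition affine_plane :: "'a set \<Rightarrow> bool" where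
  "affine_plane Q \<longleftrightarrow> Q \<subseteq> P \<and> line_closed L Q \<and>
     isomorphic_systems Q {l \<in> L. l \<subseteq> Q} (affine_points 2) (affine_lines 2)"

text \<open>The noncollinear pairs \<open>t, x\<close>, \<open>u, z\<close> and \<open>v, y\<close>
  are the three pairs of opposite edges when the six points are read as edges of a complete graph on
  four vertices.\<close>

definition dual_affine :: "'a \<Rightarrow> 'a \<Rightarrow> 'a \<Rightarrow> 'a \<Rightarrow> 'a \<Rightarrow> 'a \<Rightarrow> bool" where
  "dual_affine x y z t u v \<longleftrightarrow> {x, y, z} \<in> L \<and> {t, y, u} \<in> L \<and> {t, z, v} \<in> L \<and> {x, u, v} \<in> L \<and>
     \<not> col t x \<and> \<not> col u z \<and> \<not> col v y"

lemma affine_plane_coordinates: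
  assumes "affine_plane Q"
  obtains f where "inj_on f Q" "f ` Q = affine_points 2"
    "\<And>p q. p \<in> Q \<Longrightarrow> q \<in> Q \<Longrightarrow> p \<noteq> q \<Longrightarrow> col p q \<and> third p q \<in> Q \<and> f (third p q) = - f p - f q"
proof -
  have iso: "isomorphic_systems Q {l \<in> L. l \<subseteq> Q} (affine_points 2) (affine_lines 2)"
    using assms unfolding affine_plane_def by simp
  obtain f where f: "bij_betw f Q (affine_points 2)"
    "\<And>p q r. p \<in> Q \<Longrightarrow> q \<in> Q \<Longrightarrow> r \<in> Q \<Longrightarrow>
       {f p, f q, f r} \<in> affine_lines 2 \<longleftrightarrow> {p, q, r} \<in> {l \<in> L. l \<subseteq> Q}"
    "affine_lines 2 = (\<lambda>l. f ` l) ` {l \<in> L. l \<subseteq> Q}"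
    by (rule isomorphic_systemsE[OF iso]) auto
  have inj: "inj_on f Q" and im: "f ` Q = affine_points 2" using f(1) by (auto simp: bij_betw_def)
  have "col p q \<and> third p q \<in> Q \<and> f (third p q) = - f p - f q" if "p \<in> Q" "q \<in> Q" "p \<noteq> q" for p q
  proof -
    have fpq: "f p \<in> affine_points 2" "f q \<in> affine_points 2" using that im by auto
    then have "- f p - f q \<in> affine_points 2" by (auto simp: affine_points_def)
    then obtain r where r: "r \<in> Q" "f r = - f p - f q" using im by (metis imageE)
    have "f p \<noteq> f q" using that inj by (auto dest: inj_onD)
    moreover have "(\<lambda>i. - f p i - f q i) = - f p - f q" by auto
    ultimately have "{f p, f q, f r} \<in> affine_lines 2" unfolding affine_lines_def r(2) using fpq by force
    then have "{p, q, r} \<in> L" using f(2)[OF that(1,2) r(1)] by blast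
    then show ?thesis using r third_eq line_col by metis
  qed
  then show ?thesis using that inj im by blast
qed

lemma affine_plane_col:
  assumes Q: "affine_plane Q" and "p \<in> Q" "q \<in> Q" "p \<noteq> q"
  shows "col p q"
proof -
  obtain f where inj: "inj_on f Q" and im: "f ` Q = affine_points 2"
    and f: "\<And>p q. p \<in> Q \<Longrightarrow> q \<in> Q \<Longrightarrow> p \<noteq> q \<Longrightarrow> col p q \<and> third p q \<in> Q \<and> f (third p q) = - f p - f q"
    using affine_plane_coordinates[OF Q] by blast
  show ?thesis using f assms by blast
qed

lemma affine_plane_outside_line:
  assumes Q: "affine_plane Q"
  shows "\<exists>w\<in>Q. w \<notin> {a, b, c}"
proof -
  obtain f where inj: "inj_on f Q" and im: "f ` Q = affine_points 2"
    and f: "\<And>p q. p \<in> Q \<Longrightarrow> q \<in> Q \<Longrightarrow> p \<noteq> q \<Longrightarrow> col p q \<and> third p q \<in> Q \<and> f (third p q) = - f p - f q"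
    using affine_plane_coordinates[OF Q] by blast
  show ?thesis using affine_points_not_subset_3[of "f a" "f b" "f c"] unfolding im[symmetric] by auto
qed

text \<open>The two lines through \<open>b\<close> cover everything except \<open>a\<close>. The
  third point of a line through \<open>a\<close> and \<open>b\<close> would lie on one of them,
  which would then share two points with the new line.\<close>

lemma two_lines_noncol:
  assumes cl: "line_closed L Q" and Q: "Q \<subseteq> {a, b, c, d, c', d'}" "a \<in> Q" "b \<in> Q" and l: "{b, c, d} \<in> L" "{b, c', d'} \<in> L"
    and a: "a \<notin> {c, d, c', d'}"
  shows "\<not> col a b"
proof
  assume ab: "col a b"
  define e where "e = third a b"
  have e: "{a, b, e} \<in> L" using third_line[OF ab] unfolding e_def .
  then have "e \<in> {a, b, c, d, c', d'}" using line_closedD[OF cl] Q by blast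
  moreover have "e \<noteq> a" "e \<noteq> b" using line_distinct[OF e] by auto
  moreover have e': "{b, e, a} \<in> L" using e by (simp add: insert_commute)
  have "e \<noteq> c" "e \<noteq> c'" using line_unique e' l a by blast+
  moreover have "{b, d, c} \<in> L" "{b, d', c'} \<in> L" using l by (simp_all add: insert_commute)
  then have "e \<noteq> d" "e \<noteq> d'" using line_unique e' a by blast+
  ultimately show False by blast
qed

lemma dual_affine_plane:
  assumes cl: "line_closed L Q"
    and iso: "isomorphic_systems Q {l \<in> L. l \<subseteq> Q} dual_affine_points dual_affine_lines"
    and l: "l \<in> L" "l \<subseteq> Q" and t: "t \<in> Q - l"
  obtains x y z u v where "l = {x, y, z}" "dual_affine x y z t u v"
proof -
  obtain f where f: "bij_betw f Q dual_affine_points"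
    "\<And>p q r. p \<in> Q \<Longrightarrow> q \<in> Q \<Longrightarrow> r \<in> Q \<Longrightarrow>
       {f p, f q, f r} \<in> dual_affine_lines \<longleftrightarrow> {p, q, r} \<in> {l \<in> L. l \<subseteq> Q}"
    "dual_affine_lines = (\<lambda>l. f ` l) ` {l \<in> L. l \<subseteq> Q}"
    by (rule isomorphic_systemsE[OF iso]) auto
  have inj: "inj_on f Q" and im: "f ` Q = dual_affine_points" using f(1) by (auto simp: bij_betw_def)
  have "f ` l \<in> dual_affine_lines" using f(3) l by auto
  moreover have "f t \<in> dual_affine_points - f ` l" using inj im t l(2) by (auto dest: inj_onD)
  ultimately obtain x' y' z' u' v' where lab: "f ` l = {x', y', z'}" "{f t, y', u'} \<in> dual_affine_lines"
    "{f t, z', v'} \<in> dual_affine_lines" "{x', u', v'} \<in> dual_affine_lines"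
    "distinct [x', y', z', f t, u', v']" "dual_affine_points = {x', y', z', f t, u', v'}"
    by (rule dual_affine_labelling)
  have "x' \<in> f ` Q" "y' \<in> f ` Q" "z' \<in> f ` Q" "u' \<in> f ` Q" "v' \<in> f ` Q"
    unfolding im lab(6) by simp_all
  then obtain x y z u v where q: "x \<in> Q" "y \<in> Q" "z \<in> Q" "u \<in> Q" "v \<in> Q"
    and e: "x' = f x" "y' = f y" "z' = f z" "u' = f u" "v' = f v"
    by (elim imageE)
  have tQ: "t \<in> Q" using t by auto
  have "f ` l = f ` {x, y, z}" using lab(1) e by simp
  moreover have "{x, y, z} \<subseteq> Q" using q by simp
  ultimately have lxyz: "l = {x, y, z}" using inj_on_image_eq_iff[OF inj l(2)] by metis
  have "f ` Q = f ` {x, y, z, t, u, v}" using im lab(6) e by simp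
  moreover have "{x, y, z, t, u, v} \<subseteq> Q" using q tQ by simp
  ultimately have Q: "Q = {x, y, z, t, u, v}" using inj_on_image_eq_iff[OF inj order_refl] by metis
  have lines: "{x, y, z} \<in> L" "{t, y, u} \<in> L" "{t, z, v} \<in> L" "{x, u, v} \<in> L"
    using lab(2-4)[unfolded e] f(2)[OF tQ q(2,4)] f(2)[OF tQ q(3,5)] f(2)[OF q(1,4,5)] l(1)[unfolded lxyz]
    by simp_all
  have dist: "distinct [x, y, z, t, u, v]" using lab(5) e by auto
  have "\<not> col t x"
    using lines dist by (intro two_lines_noncol[OF cl, of t x y z u v]) (auto simp: Q)
  moreover have "\<not> col u z"
    using lines dist by (intro two_lines_noncol[OF cl, of u z x y t v]) (auto simp: Q insert_commute)
  moreover have "\<not> col v y"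
    using lines dist by (intro two_lines_noncol[OF cl, of v y x z t u]) (auto simp: Q insert_commute)
  ultimately have "dual_affine x y z t u v" using lines unfolding dual_affine_def by auto
  then show ?thesis using lxyz that by blast
qed

end

locale jordan_fischer = jordan_matsuo P L \<delta> for P :: "'a set" and L and \<delta> :: "'f::field" +
  assumes fischer: "fischer_space P L" and connected: "connected_system P L"
begin

text \<open>The plane is generated by \<open>l\<close> and the line joining \<open>t\<close> to
  \<open>y\<close>; the Fischer axiom leaves the two cases.\<close>

lemma line_point_plane:
  assumes l: "l \<in> L" and t: "t \<notin> l" and y: "y \<in> l" "col t y"
  obtains (affine) Q where "affine_plane Q" "l \<subseteq> Q" "t \<in> Q"
    | (dual) x y z u v where "l = {x, y, z}" "dual_affine x y z t u v"
proof -
  obtain m where m: "m \<in> L" "t \<in> m" "y \<in> m" using y unfolding collinear_def by auto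
  have "l \<union> m \<subseteq> P" using l m line_subset by auto
  then obtain Q where Q: "generated_subsystem P L (l \<union> m) Q {l \<in> L. l \<subseteq> Q}" "line_closed L Q"
    "l \<union> m \<subseteq> Q" "Q \<subseteq> P"
    by (rule exists_generated_subsystem)
  have "plane P L Q {l \<in> L. l \<subseteq> Q}" unfolding plane_def using l m t y Q(1) by blast
  then consider "isomorphic_systems Q {l \<in> L. l \<subseteq> Q} dual_affine_points dual_affine_lines"
    | "affine_plane Q"
    using fischer Q unfolding fischer_space_def affine_plane_def by blast
  then show ?thesis
  proof cases
    case 1
    then show ?thesis using dual_affine_plane[OF Q(2) 1 l, of t] Q(3) t m(2) dual by blast
  next
    case 2
    then show ?thesis using affine Q(3) m(2) by blast
  qed
qed

text \<open>Any \<open>p\<close> of the plane off the line through \<open>x\<close> and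
  \<open>y\<close> gives a configuration for \<open>affine_configuration\<close>. In coordinates,
  \<open>w' = z\<close> would force \<open>f p = f x\<close>, and \<open>v' = z\<close> would force
  \<open>f p = f z\<close>.\<close>

lemma affine_plane_col_iff:
  assumes Q: "affine_plane Q" and t: "t \<in> P" "t \<notin> Q" and xy: "x \<in> Q" "y \<in> Q"
  shows "col x t \<longleftrightarrow> col y t"
proof (cases "x = y")
  case False
  obtain f where inj: "inj_on f Q" and im: "f ` Q = affine_points 2"
    and f: "\<And>p q. p \<in> Q \<Longrightarrow> q \<in> Q \<Longrightarrow> p \<noteq> q \<Longrightarrow> col p q \<and> third p q \<in> Q \<and> f (third p q) = - f p - f q"
    using affine_plane_coordinates[OF Q] by blast
  define z where "z = third x y"
  have z: "z \<in> Q" "f z = - f x - f y" "{x, y, z} \<in> L" using f[OF xy False] third_line unfolding z_def by auto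
  obtain p where p: "p \<in> Q" "f p \<notin> {f x, f y, f z}"
    using affine_points_not_subset_3[of "f x" "f y" "f z"] im by (metis imageE)
  then have pne: "p \<noteq> x" "p \<noteq> y" "p \<noteq> z" by auto
  have fxy: "f x \<noteq> f y" using False xy inj by (auto dest: inj_onD)
  define q where "q = third p y"
  have q: "q \<in> Q" "f q = - f p - f y" "{p, q, y} \<in> L"
    using f[OF p(1) xy(2) pne(2)] third_line[of p y] unfolding q_def by (auto simp: insert_commute)
  have "q \<noteq> x" using q(2) p(2) z(2) by auto
  define w where "w = third q x"
  have w: "w \<in> Q" "f w = - f q - f x" "{q, x, w} \<in> L"
    using f[OF q(1) xy(1) \<open>q \<noteq> x\<close>] third_line[of q x] unfolding w_def by auto
  define v where "v = third x p"
  have v: "v \<in> Q" "f v = - f x - f p" "{x, p, v} \<in> L"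
    using f[OF xy(1) p(1)] pne third_line[of x p] unfolding v_def by auto
  have "w \<noteq> p" using w(2) q(2) fxy by (auto simp: algebra_simps)
  define w' where "w' = third w p"
  have w': "w' \<in> Q" "f w' = - f w - f p" "{w, p, w'} \<in> L"
    using f[OF w(1) p(1) \<open>w \<noteq> p\<close>] third_line[of w p] unfolding w'_def by auto
  have "- f x - f p \<noteq> - f p - f y"
    using fxy by (metis add.commute add_left_cancel diff_conv_add_uminus neg_equal_iff_equal)
  then have "v \<noteq> q" using v(2) q(2) by auto
  define v' where "v' = third v q"
  have v': "v' \<in> Q" "f v' = - f v - f q" "{v, q, v'} \<in> L"
    using f[OF v(1) q(1) \<open>v \<noteq> q\<close>] third_line[of v q] unfolding v'_def by auto
  have "w' \<noteq> z"
  proof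
    assume "w' = z"
    then have "f x + f x = f p + f p" using w' w q z by (auto simp: algebra_simps)
    then show False using p(2) unfolding three_torsion_fun by auto
  qed
  moreover have "v' \<noteq> z"
  proof
    assume "v' = z"
    then have "(f x + f x) + (f p + f p) + (f y + f y) = 0" using v' v q z by (auto simp: algebra_simps)
    then have zero: "- f x + - f p + - f y = 0" unfolding three_torsion_fun .
    have "f p = - (- f x + - f p + - f y) + (- f x - f y)" by (simp add: algebra_simps)
    then have "f p = f z" unfolding zero z(2) by simp
    then show False using p(2) by auto
  qed
  ultimately show ?thesis
    using affine_configuration[OF _ t(2,1) xy p(1) z(3) q(3) w(3) v(3) w'(3) v'(3) pne(3)] Q
    unfolding affine_plane_def by blast
qed simp

text \<open>A line of \<open>Q\<close> through \<open>x\<close> consists of points collinear with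
  \<open>t\<close>. In a dual affine plane some point of that line would not be collinear with
  \<open>t\<close>, so the plane spanned by the line and \<open>t\<close> is affine.\<close>

lemma affine_plane_spread:
  assumes Q: "affine_plane Q" "x \<in> Q" "col x t"
  obtains Q' where "affine_plane Q'" "x \<in> Q'" "t \<in> Q'"
proof (cases "t \<in> Q")
  case False
  obtain y where y: "y \<in> Q" "x \<noteq> y" using affine_plane_outside_line[OF Q(1), of x x x] by blast
  define z where "z = third x y"
  have xy: "col x y" using affine_plane_col[OF Q(1,2) y] .
  have z: "{x, y, z} \<in> L" "z \<in> Q"
    using third_line[OF xy] third_closed[OF _ xy Q(2) y(1)] Q(1) unfolding z_def affine_plane_def by auto
  have colt: "col t p" if "p \<in> {x, y, z}" for p
    using affine_plane_col_iff[OF Q(1) _ False Q(2), of p] Q(2,3) y z(2) that col_points(2)[OF Q(3)] col_sym by auto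
  have "t \<notin> {x, y, z}" using False Q y z by auto
  then show ?thesis
  proof (rule line_point_plane[OF z(1)])
    show "x \<in> {x, y, z}" "col t x" using colt by auto
  next
    fix Q' assume "affine_plane Q'" "{x, y, z} \<subseteq> Q'" "t \<in> Q'"
    then show thesis using that by auto
  next
    fix x' y' z' u v assume l: "{x, y, z} = {x', y', z'}" and "dual_affine x' y' z' t u v"
    then have "\<not> col t x'" unfolding dual_affine_def by simp
    then show thesis using colt l by blast
  qed
qed (use that Q in blast)

lemma affine_plane_all_collinear:
  assumes Q: "affine_plane Q" and pq: "p \<in> P" "q \<in> P" "p \<noteq> q"
  shows "col p q"
proof -
  obtain o' where o': "o' \<in> Q" using affine_plane_outside_line[OF Q] by blast
  then have "o' \<in> P" using Q unfolding affine_plane_def by auto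
  \<comment> \<open>Connectedness is used twice: first membership in an affine plane spreads to
    every point, then collinearity with \<open>p\<close> spreads to every other point.\<close>
  have "p \<in> {p. \<exists>Q. affine_plane Q \<and> p \<in> Q}"
    by (rule connected_system_induct[OF connected \<open>o' \<in> P\<close>])
      (use Q o' pq affine_plane_spread in \<open>blast+\<close>)
  then obtain R where R: "affine_plane R" "p \<in> R" by auto
  have "q \<in> {q. q = p \<or> col p q}"
  proof (rule connected_system_induct[OF connected \<open>p \<in> P\<close> _ _ \<open>q \<in> P\<close>])
    fix q s assume q: "q \<in> {q. q = p \<or> col p q}" "col q s"
    show "s \<in> {q. q = p \<or> col p q}"
    proof (cases "q = p \<or> s = p")
      case False
      then have "col p q" using q by auto
      \<comment> \<open>If \<open>s\<close> lies outside a plane through \<open>p\<close> and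
        \<open>q\<close>, its collinearity with \<open>q\<close> carries over to
        \<open>p\<close>.\<close>
      then obtain S where S: "affine_plane S" "p \<in> S" "q \<in> S" using affine_plane_spread R by blast
      show ?thesis
      proof (cases "s \<in> S")
        case True
        then show ?thesis using affine_plane_col[OF S(1,2)] by blast
      next
        case False
        then show ?thesis using affine_plane_col_iff[OF S(1) _ False] S q col_points by blast
      qed
    qed (use q in auto)
  qed simp
  then show ?thesis using pq by auto
qed

end

section \<open>Fischer spaces without affine planes\<close>

text \<open>A labelling of points by the edges of the complete graph on \<open>{1..m}\<close>, with \<open>g i j\<close> the
  point of the edge \<open>ij\<close>; the values \<open>g i i\<close> are irrelevant.\<close>

definition (in pts) edge_labelling :: "nat \<Rightarrow> (nat \<Rightarrow> nat \<Rightarrow> 'a) \<Rightarrow> bool" where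
  "edge_labelling m g \<longleftrightarrow>
     (\<forall>i\<in>{1..m}. \<forall>j\<in>{1..m}. i \<noteq> j \<longrightarrow> g i j \<in> P \<and> g i j = g j i) \<and>
     (\<forall>i\<in>{1..m}. \<forall>j\<in>{1..m}. \<forall>k\<in>{1..m}. i \<noteq> j \<longrightarrow> j \<noteq> k \<longrightarrow> i \<noteq> k \<longrightarrow> {g i j, g j k, g i k} \<in> L) \<and>
     (\<forall>i\<in>{1..m}. \<forall>j\<in>{1..m}. \<forall>k\<in>{1..m}. \<forall>l\<in>{1..m}. distinct [i, j, k, l] \<longrightarrow>
        g i j \<noteq> g k l \<and> \<not> col (g i j) (g k l))"

definition edge_points :: "nat \<Rightarrow> (nat \<Rightarrow> nat \<Rightarrow> 'a) \<Rightarrow> 'a set" where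
  "edge_points m g = {g i j | i j. i \<in> {1..m} \<and> j \<in> {1..m} \<and> i \<noteq> j}"

section \<open>Edges, triangles and the closed set they form\<close>

context pts
begin

context
  fixes m g assumes g: "edge_labelling m g"
begin

lemma edge_in_P: "i \<in> {1..m} \<Longrightarrow> j \<in> {1..m} \<Longrightarrow> i \<noteq> j \<Longrightarrow> g i j \<in> P"
  and edge_sym: "i \<in> {1..m} \<Longrightarrow> j \<in> {1..m} \<Longrightarrow> i \<noteq> j \<Longrightarrow> g i j = g j i"
  and edge_line: "i \<in> {1..m} \<Longrightarrow> j \<in> {1..m} \<Longrightarrow> k \<in> {1..m} \<Longrightarrow> i \<noteq> j \<Longrightarrow> j \<noteq> k \<Longrightarrow> i \<noteq> k \<Longrightarrow>
    {g i j, g j k, g i k} \<in> L"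
  and edge_disjoint: "i \<in> {1..m} \<Longrightarrow> j \<in> {1..m} \<Longrightarrow> k \<in> {1..m} \<Longrightarrow> l \<in> {1..m} \<Longrightarrow>
    distinct [i, j, k, l] \<Longrightarrow> g i j \<noteq> g k l \<and> \<not> col (g i j) (g k l)"
  using g unfolding edge_labelling_def by blast+

lemma edge_in_points: "i \<in> {1..m} \<Longrightarrow> j \<in> {1..m} \<Longrightarrow> i \<noteq> j \<Longrightarrow> g i j \<in> edge_points m g"
  unfolding edge_points_def by blast

lemma edge_points_subset: "edge_points m g \<subseteq> P"
  unfolding edge_points_def using edge_in_P by blast

lemma edge_pointsE:
  assumes "p \<in> edge_points m g"
  obtains i j where "i \<in> {1..m}" "j \<in> {1..m}" "i \<noteq> j" "p = g i j"
  using assms unfolding edge_points_def by blast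

text \<open>A labelling demands distinctness only for disjoint edges; edges sharing a vertex lie on
  a common line, whose three points are distinct.\<close>

lemma edge_eq_iff:
  assumes "i \<in> {1..m}" "j \<in> {1..m}" "i \<noteq> j" "k \<in> {1..m}" "l \<in> {1..m}" "k \<noteq> l"
  shows "g i j = g k l \<longleftrightarrow> {i, j} = {k, l}"
proof
  assume eq: "g i j = g k l"
  have sh: "g a b \<noteq> g a c" if "a \<in> {1..m}" "b \<in> {1..m}" "c \<in> {1..m}" "a \<noteq> b" "a \<noteq> c" "b \<noteq> c" for a b c
    using line_distinct(2)[OF edge_line[of b a c]] line_distinct(1)[OF edge_line[of b a c]] edge_sym that by metis
  show "{i, j} = {k, l}"
  proof (rule ccontr)
    assume ne: "{i, j} \<noteq> {k, l}"
    consider "distinct [i, j, k, l]" | "i = k" "j \<noteq> l" | "i = l" "j \<noteq> k" | "j = k" "i \<noteq> l" | "j = l" "i \<noteq> k"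
      using assms ne by (auto simp: doubleton_eq_iff)
    then show False
    proof cases
      case 1
      then show ?thesis using edge_disjoint assms eq by blast
    next
      case 2
      then show ?thesis using sh[of i j l] assms eq by auto
    next
      case 3
      then show ?thesis using sh[of i j k] edge_sym[of k l] assms eq by auto
    next
      case 4
      then show ?thesis using sh[of j i l] edge_sym[of i j] assms eq by auto
    next
      case 5
      then show ?thesis using sh[of j i k] edge_sym[of i j] edge_sym[of k l] assms eq by auto
    qed
  qed
next
  assume "{i, j} = {k, l}"
  then show "g i j = g k l" using edge_sym assms by (auto simp: doubleton_eq_iff)
qed

text \<open>Collinear edges are neither equal nor disjoint, so they share a vertex, and the line of
  their triangle is the only line through both. Thus no line leaves the labelled set after two
  points.\<close>

lemma edge_line_cases:
  assumes "{p, q, r} \<in> L" "p \<in> edge_points m g" "q \<in> edge_points m g"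
  obtains i j k where "i \<in> {1..m}" "j \<in> {1..m}" "k \<in> {1..m}" "i \<noteq> j" "j \<noteq> k" "i \<noteq> k"
    "p = g i j" "q = g j k" "r = g i k"
proof -
  obtain i j where p: "i \<in> {1..m}" "j \<in> {1..m}" "i \<noteq> j" "p = g i j" using edge_pointsE[OF assms(2)] .
  obtain k l where q: "k \<in> {1..m}" "l \<in> {1..m}" "k \<noteq> l" "q = g k l" using edge_pointsE[OF assms(3)] .
  have "col p q" "p \<noteq> q" using line_col[OF assms(1)] line_distinct[OF assms(1)] by auto
  then have "\<not> distinct [i, j, k, l]" "{i, j} \<noteq> {k, l}" using edge_disjoint edge_eq_iff p q by blast+
  then obtain a b c where "{a, b, c} \<subseteq> {1..m}" "a \<noteq> b" "b \<noteq> c" "a \<noteq> c" "{i, j} = {a, b}" "{k, l} = {b, c}"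
    using p q that by (auto simp: doubleton_eq_iff)
  then have abc: "a \<in> {1..m}" "b \<in> {1..m}" "c \<in> {1..m}" "a \<noteq> b" "b \<noteq> c" "a \<noteq> c" "p = g a b" "q = g b c"
    using p q edge_eq_iff by auto
  moreover have "r = g a c" using edge_line[of a b c] assms(1) line_unique abc by metis
  ultimately show ?thesis using that by blast
qed

lemma edge_points_closed: "line_closed L (edge_points m g)"
  unfolding line_closed_def using edge_line_cases edge_in_points by metis

end

end

section \<open>Parity of collinearity along lines\<close>

locale jordan_dual_fischer = jordan_fischer P L \<delta> for P :: "'a set" and L and \<delta> :: "'f::field" +
  assumes no_affine_plane: "\<not> affine_plane Q"
begin

lemma dual_affine_exists:
  assumes "l \<in> L" "t \<notin> l" "y \<in> l" "col t y"
  obtains x y z u v where "l = {x, y, z}" "dual_affine x y z t u v"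
  by (rule line_point_plane[OF assms]) (use no_affine_plane that in auto)

text \<open>In the dual affine plane through the line and \<open>t\<close>, exactly one point of the
  line is not collinear with \<open>t\<close>, and that must be \<open>x\<close>. The other two
  labels are fixed up to a swap, which preserves the configuration.\<close>

lemma dual_affine_around:
  assumes "{x, y, z} \<in> L" "t \<notin> {x, y, z}" "\<not> col t x" "col t y"
  shows "col t z" "{third t y, third t z, x} \<in> L" "\<not> col (third t y) z" "\<not> col (third t z) y"
proof -
  obtain x' y' z' u v where d: "{x, y, z} = {x', y', z'}" "dual_affine x' y' z' t u v"
    by (rule dual_affine_exists[OF assms(1,2) _ assms(4)]) auto
  have d': "{x', y', z'} \<in> L" "{t, y', u} \<in> L" "{t, z', v} \<in> L" "{x', u, v} \<in> L"
    "\<not> col t x'" "\<not> col u z'" "\<not> col v y'"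
    using d(2) unfolding dual_affine_def by auto
  have c: "col t y'" "col t z'" using line_col(1) d'(2,3) by auto
  have dist: "x \<noteq> y" "x \<noteq> z" "y \<noteq> z" "x' \<noteq> y'" "x' \<noteq> z'" "y' \<noteq> z'"
    using line_distinct[OF assms(1)] line_distinct[OF d'(1)] by auto
  have "x = x'" using d(1) c assms(3) by auto
  moreover have "y \<in> {x', y', z'}" "z \<in> {x', y', z'}" unfolding d(1)[symmetric] by simp_all
  ultimately consider "y = y'" "z = z'" | "y = z'" "z = y'" using dist by auto
  moreover have "third t y' = u" "third t z' = v" using third_eq d'(2,3) by auto
  ultimately show "col t z" "{third t y, third t z, x} \<in> L" "\<not> col (third t y) z" "\<not> col (third t z) y"
    using c d' \<open>x = x'\<close> by (cases; auto simp: insert_commute)+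
qed

lemma line_not_all_collinear:
  assumes "{x, y, z} \<in> L" "t \<notin> {x, y, z}" "col t x" "col t y"
  shows "\<not> col t z"
proof
  assume "col t z"
  obtain x' y' z' u v where d: "{x, y, z} = {x', y', z'}" "dual_affine x' y' z' t u v"
    by (rule dual_affine_exists[OF assms(1,2) _ assms(4)]) auto
  then have "x' \<in> {x, y, z}" "\<not> col t x'" unfolding dual_affine_def by auto
  then show False using assms \<open>col t z\<close> by auto
qed

text \<open>An outside point is collinear with none or exactly two points of a line: one collinear
  point already produces a dual affine plane. Collinearity with \<open>t\<close> is thus additive
  modulo 2 along lines.\<close>

lemma line_parity:
  assumes "{x, y, z} \<in> L" "t \<notin> {x, y, z}"
  shows "col t z \<longleftrightarrow> \<not> (col t x \<longleftrightarrow> col t y)"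
proof -
  have perm: "{y, x, z} \<in> L" "{x, z, y} \<in> L" "{y, z, x} \<in> L" using assms by (auto simp: insert_commute)
  show ?thesis
    using dual_affine_around(1)[OF assms(1), of t] dual_affine_around(1)[OF perm(1), of t]
      dual_affine_around(1)[OF perm(2), of t] dual_affine_around(1)[OF perm(3), of t]
      line_not_all_collinear[OF assms] assms(2) by blast
qed

section \<open>Adjoining a point to a labelled complete graph\<close>

context
  fixes m g t
  assumes g: "edge_labelling m g" and t: "t \<in> P" "t \<notin> edge_points m g"
begin

text \<open>Parity on triangles says that the edges collinear with \<open>t\<close> form a cut of
  the complete graph. If both sides had two vertices, \<open>i, j\<close> and \<open>k, l\<close>,
  then the opposite edges \<open>ij\<close>, \<open>kl\<close> would contribute 0 and
  \<open>ik\<close>, \<open>jl\<close> would contribute 2, against the balance. So one side is a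
  single vertex.\<close>

lemma edge_star:
  assumes "p \<in> edge_points m g" "col t p"
  obtains a where "a \<in> {1..m}"
    "\<And>i j. i \<in> {1..m} \<Longrightarrow> j \<in> {1..m} \<Longrightarrow> i \<noteq> j \<Longrightarrow> col t (g i j) \<longleftrightarrow> a \<in> {i, j}"
proof -
  note starI = that
  let ?V = "{1..m}"
  have mem: "g i j \<in> edge_points m g" if "i \<in> ?V" "j \<in> ?V" "i \<noteq> j" for i j
    using edge_in_points[OF g] that .
  have sym: "g i j = g j i" if "i \<in> ?V" "j \<in> ?V" "i \<noteq> j" for i j
    using edge_sym[OF g] that .
  have par: "col t (g i k) \<longleftrightarrow> \<not> (col t (g i j) \<longleftrightarrow> col t (g j k))"
    if "i \<in> ?V" "j \<in> ?V" "k \<in> ?V" "i \<noteq> j" "j \<noteq> k" "i \<noteq> k" for i j k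
    using line_parity[OF edge_line[OF g that], of t] mem that t by blast
  have bal: "(of_bool (col t (g i j)) + of_bool (col t (g k l)) :: nat) =
      of_bool (col t (g i k)) + of_bool (col t (g j l))"
    if V: "i \<in> ?V" "j \<in> ?V" "k \<in> ?V" "l \<in> ?V" and d: "distinct [i, j, k, l]" for i j k l
  proof -
    have s: "g j i = g i j" "g k i = g i k" "g l i = g i l" "g k j = g j k" "g l j = g j l" "g l k = g k l"
      using sym V d by auto
    have lines: "{g i j, g i k, g j k} \<in> L" "{g i j, g i l, g j l} \<in> L" "{g i k, g i l, g k l} \<in> L"
      "{g j k, g j l, g k l} \<in> L"
      using edge_line[OF g, of j i k] edge_line[OF g, of j i l] edge_line[OF g, of k i l] edge_line[OF g, of k j l]
        V d s by auto
    have "\<not> col (g i j) (g k l)" "g i j \<noteq> g k l" "g i k \<noteq> g j l" "g i l \<noteq> g j k"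
      using edge_disjoint[OF g] V d by auto
    moreover have "distinct [g i j, g i k, g i l, g j k, g j l, g k l]"
      using lines[THEN line_distinct(1)] lines[THEN line_distinct(2)] lines[THEN line_distinct(3)] calculation by auto
    ultimately show ?thesis
      using dual_affine_balance[OF edge_points_closed[OF g] t(2,1) _ _ _ _ _ _ lines] mem V d
      by (simp add: col_sym[of t])
  qed
  obtain a b where ab: "a \<in> ?V" "b \<in> ?V" "a \<noteq> b" "col t (g a b)"
    using edge_pointsE[OF g assms(1)] assms(2) by metis
  have star: thesis if ab: "a \<in> ?V" "b \<in> ?V" "a \<noteq> b" "col t (g a b)"
    and c: "\<And>c. c \<in> ?V \<Longrightarrow> c \<noteq> a \<Longrightarrow> c \<noteq> b \<Longrightarrow> col t (g a c)" for a b
  proof (rule starI[OF ab(1)])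
    fix i j assume V: "i \<in> ?V" "j \<in> ?V" "i \<noteq> j"
    have all: "col t (g a c)" if "c \<in> ?V" "c \<noteq> a" for c using ab c that by (cases "c = b") auto
    show "col t (g i j) \<longleftrightarrow> a \<in> {i, j}"
    proof (cases "a \<in> {i, j}")
      case True
      then show ?thesis using all[of i] all[of j] V sym[OF V] by auto
    next
      case False
      then show ?thesis using par[of i a j] all[of i] all[of j] V sym[of a i] ab by auto
    qed
  qed
  show thesis
  \<comment> \<open>A second collinear edge at \<open>a\<close> makes \<open>a\<close> the centre.
    Otherwise parity makes every edge at \<open>b\<close> collinear with \<open>t\<close>, and the
    centre is \<open>b\<close>.\<close>
  proof (cases "\<exists>c\<in>?V. c \<noteq> a \<and> c \<noteq> b \<and> col t (g a c)")
    case True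
    then obtain c where c: "c \<in> ?V" "c \<noteq> a" "c \<noteq> b" "col t (g a c)" by blast
    have bc: "\<not> col t (g b c)" using par[of a b c] ab c by auto
    have "col t (g a d)" if "d \<in> ?V" "d \<noteq> a" "d \<noteq> b" for d
    proof (cases "d = c")
      case False
      have "(of_bool (col t (g a b)) + of_bool (col t (g d c)) :: nat) =
        of_bool (col t (g a d)) + of_bool (col t (g b c))"
        using bal[of a b d c] that c ab False by auto
      then show ?thesis using ab bc by (auto simp: of_bool_def split: if_splits)
    qed (use c in auto)
    then show ?thesis using star[OF ab] by blast
  next
    case False
    have "col t (g b c)" if "c \<in> ?V" "c \<noteq> b" "c \<noteq> a" for c
      using par[of a b c] False that ab by auto
    then show ?thesis using star[of b a] ab sym[of a b] by auto
  qed
qed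

lemma edge_extend:
  assumes "p \<in> edge_points m g" "col t p"
  obtains g' where "edge_labelling (Suc m) g'" "edge_points m g \<subseteq> edge_points (Suc m) g'"
    "t \<in> edge_points (Suc m) g'"
proof -
  let ?V = "{1..m}" and ?n = "Suc m"
  obtain a where a: "a \<in> ?V"
    and star: "\<And>i j. i \<in> ?V \<Longrightarrow> j \<in> ?V \<Longrightarrow> i \<noteq> j \<Longrightarrow> col t (g i j) \<longleftrightarrow> a \<in> {i, j}"
    using edge_star[OF assms] by blast
  note gP = edge_in_P[OF g] and gs = edge_sym[OF g] and gl = edge_line[OF g] and gd = edge_disjoint[OF g]
    and gm = edge_in_points[OF g]
  \<comment> \<open>\<open>w i\<close> is to be the edge from \<open>i\<close> to the new vertex
    \<open>Suc m\<close>. With \<open>t\<close> as the edge at the centre \<open>a\<close>, the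
    triangle on \<open>a\<close>, \<open>i\<close> and the new vertex forces the remaining
    values.\<close>
  define w where "w i = (if i = a then t else third t (g a i))" for i
  define g' where "g' i j = (if i = ?n then w j else if j = ?n then w i else g i j)" for i j
  have wline: "{t, g a i, w i} \<in> L" if "i \<in> ?V" "i \<noteq> a" for i
    using third_line[of t "g a i"] star[of a i] a that unfolding w_def by auto
  have wP: "w i \<in> P" if "i \<in> ?V" for i
    using wline[of i] that t line_points by (cases "i = a") (auto simp: w_def)
  have wout: "w i \<notin> edge_points m g" if "i \<in> ?V" for i
  proof (cases "i = a")
    case True
    then show ?thesis using t by (simp add: w_def)
  next
    case False
    then show ?thesis
      \<comment> \<open>A labelled \<open>w i\<close> would put two points of its line into the
        closed set, and then also \<open>t\<close>.\<close>
      using line_closedD[OF edge_points_closed[OF g], of "w i" "g a i" t] wline[of i] gm[of a i] that a t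
      by (auto simp: insert_commute)
  qed
  have w3: "{w i, w j, g i j} \<in> L" if V: "i \<in> ?V" "j \<in> ?V" "i \<noteq> j" for i j
  proof -
    consider "i = a" | "j = a" | "i \<noteq> a" "j \<noteq> a" by blast
    then show ?thesis
    proof cases
      case 1
      then show ?thesis using wline[of j] V by (auto simp: w_def insert_commute)
    next
      case 2
      then show ?thesis using wline[of i] V gs[of i a] a by (auto simp: w_def insert_commute)
    next
      case 3
      \<comment> \<open>On the triangle of \<open>a\<close>, \<open>i\<close>, \<open>j\<close> the
        edge \<open>ij\<close> is the one not collinear with \<open>t\<close>; the opposite line of
        that dual affine plane is the new triangle.\<close>
      have l: "{g i j, g a i, g a j} \<in> L" using gl[of i a j] gs[of i a] 3 V a by (auto simp: insert_commute)
      have "t \<notin> {g i j, g a i, g a j}" "\<not> col t (g i j)" "col t (g a i)"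
        using t gm star 3 V a by auto
      from dual_affine_around(2)[OF l this] show ?thesis using 3 by (simp add: w_def)
    qed
  qed
  have w4: "\<not> col (w i) (g j k)" if V: "i \<in> ?V" "j \<in> ?V" "k \<in> ?V" "i \<noteq> j" "i \<noteq> k" "j \<noteq> k" for i j k
  proof (cases "i = a")
    case True
    then show ?thesis using star V by (simp add: w_def)
  next
    case False
    have key: "\<not> col (w i) (g a k)" if "k \<in> ?V" "i \<noteq> k" "k \<noteq> a" for k
    proof -
      have l: "{g i k, g a i, g a k} \<in> L" using gl[of i a k] gs[of i a] False V that a by (auto simp: insert_commute)
      have "t \<notin> {g i k, g a i, g a k}" "\<not> col t (g i k)" "col t (g a i)"
        using t gm star False V a that by auto
      from dual_affine_around(3)[OF l this] show ?thesis using False by (simp add: w_def)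
    qed
    show ?thesis
    proof (cases "a \<in> {j, k}")
      case True
      then show ?thesis using key[of j] key[of k] gs[of j k] V by auto
    next
      case nj: False
      \<comment> \<open>Parity along the line of \<open>t\<close>, \<open>g a i\<close> and
        \<open>w i\<close>: the edge \<open>jk\<close> is collinear with neither of the first two
        points, hence not with the third.\<close>
      have "g j k \<notin> {t, g a i, w i}" "\<not> col (g j k) t" "\<not> col (g j k) (g a i)"
        using wout[of i] t gm[of j k] star[of j k] gd[of j k a i] nj False V a col_sym[of t] by auto
      then show ?thesis using line_parity[OF wline[of i], of "g j k"] V False col_sym by blast
    qed
  qed
  have lab: "edge_labelling ?n g'"
    unfolding edge_labelling_def
  proof (intro conjI ballI impI)
    fix i j assume V: "i \<in> {1..?n}" "j \<in> {1..?n}" "i \<noteq> j"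
    show "g' i j \<in> P" using V wP gP unfolding g'_def by (auto simp: le_Suc_eq)
    show "g' i j = g' j i" using V gs unfolding g'_def by (auto simp: le_Suc_eq)
    fix k assume k: "k \<in> {1..?n}" "j \<noteq> k" "i \<noteq> k"
    consider "i = ?n" "j \<in> ?V" "k \<in> ?V" | "j = ?n" "i \<in> ?V" "k \<in> ?V" | "k = ?n" "i \<in> ?V" "j \<in> ?V"
      | "i \<in> ?V" "j \<in> ?V" "k \<in> ?V"
      using V k by (auto simp: le_Suc_eq)
    then show "{g' i j, g' j k, g' i k} \<in> L"
      by cases (use w3[of j k] w3[of i k] w3[of i j] gl[of i j k] V k in \<open>auto simp: g'_def insert_commute\<close>)
  next
    fix i j k l
    assume V: "i \<in> {1..?n}" "j \<in> {1..?n}" "k \<in> {1..?n}" "l \<in> {1..?n}" and d: "distinct [i, j, k, l]"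
    have inV: "x \<in> ?V" if "x \<in> {1..?n}" "x \<noteq> ?n" for x using that by auto
    have ne: "i \<noteq> j" "i \<noteq> k" "i \<noteq> l" "j \<noteq> k" "j \<noteq> l" "k \<noteq> l" using d by auto
    consider "i = ?n" "j \<in> ?V" "k \<in> ?V" "l \<in> ?V" | "j = ?n" "i \<in> ?V" "k \<in> ?V" "l \<in> ?V"
      | "k = ?n" "i \<in> ?V" "j \<in> ?V" "l \<in> ?V" | "l = ?n" "i \<in> ?V" "j \<in> ?V" "k \<in> ?V"
      | "i \<in> ?V" "j \<in> ?V" "k \<in> ?V" "l \<in> ?V"
      using inV[OF V(1)] inV[OF V(2)] inV[OF V(3)] inV[OF V(4)] ne by metis
    then have "g' i j \<noteq> g' k l \<and> \<not> col (g' i j) (g' k l)"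
    proof cases
      case 1
      then show ?thesis using w4[of j k l] wout[of j] gm[of k l] d by (auto simp: g'_def)
    next
      case 2
      then show ?thesis using w4[of i k l] wout[of i] gm[of k l] d by (auto simp: g'_def)
    next
      case 3
      then show ?thesis using w4[of l i j] wout[of l] gm[of i j] d col_sym[of "w l" "g i j"] by (auto simp: g'_def)
    next
      case 4
      then show ?thesis using w4[of k i j] wout[of k] gm[of i j] d col_sym[of "w k" "g i j"] by (auto simp: g'_def)
    next
      case 5
      then show ?thesis using gd[of i j k l] d by (auto simp: g'_def)
    qed
    then show "g' i j \<noteq> g' k l" "\<not> col (g' i j) (g' k l)" by auto
  qed
  have "edge_points m g \<subseteq> edge_points ?n g'"
  proof
    fix p assume "p \<in> edge_points m g"
    then obtain i j where "i \<in> ?V" "j \<in> ?V" "i \<noteq> j" "p = g i j" by (rule edge_pointsE[OF g])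
    then show "p \<in> edge_points ?n g'" using edge_in_points[OF lab, of i j] by (auto simp: g'_def)
  qed
  moreover have "t \<in> edge_points ?n g'"
    using edge_in_points[OF lab, of ?n a] a by (auto simp: g'_def w_def)
  ultimately show thesis using that lab by blast
qed

end

end

section \<open>Exhausting the space and counting vertices\<close>

context jordan_dual_fischer
begin

text \<open>Every extension absorbs at least one generator, so the missing generators bound the
  number of new vertices. The process can stop only when all generators are labelled, by
  connectedness.\<close>

lemma edge_exhaust:
  assumes "edge_labelling m g" "m \<ge> 2" "finite S" "generated_subsystem P L S P L"
  shows "\<exists>m' g'. edge_labelling m' g' \<and> edge_points m' g' = P \<and> 2 \<le> m' \<and>
    m' \<le> m + card (S - edge_points m g)"
  using assms(1,2)
proof (induction "card (S - edge_points m g)" arbitrary: m g rule: less_induct)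
  case less
  let ?Q = "edge_points m g"
  note g = less.prems(1)
  have gen: "S \<subseteq> P" "\<And>R. R \<subseteq> P \<Longrightarrow> line_closed L R \<Longrightarrow> S \<subseteq> R \<Longrightarrow> R = P"
    using assms(4) generates_iff by auto
  show ?case
  proof (cases "S \<subseteq> ?Q")
    case True
    then have "?Q = P" using gen edge_points_subset[OF g] edge_points_closed[OF g] by blast
    then show ?thesis using less.prems by (intro exI[of _ m] exI[of _ g]) simp
  next
    case notsub: False
    have "\<exists>s\<in>S - ?Q. \<exists>p\<in>?Q. col s p"
    proof (rule ccontr)
      assume none: "\<not> (\<exists>s\<in>S - ?Q. \<exists>p\<in>?Q. col s p)"
      \<comment> \<open>If no missing generator touches the labelled set, that set together with the
        points collinear to none of it is closed and contains all generators. It is then the whole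
        space, and connectedness excludes any point outside the labelled set.\<close>
      define N where "N = {t \<in> P. \<forall>q\<in>?Q. \<not> col t q}"
      have Ncol: "\<not> col a b" if "a \<in> ?Q" "b \<in> N" for a b
        using that col_sym unfolding N_def by blast
      have third_N: "r \<in> ?Q \<union> N" if l: "{p, q, r} \<in> L" and p: "p \<in> N" and q: "q \<in> N" for p q r
      proof (cases "r \<in> ?Q")
        case False
        \<comment> \<open>Parity again: a point collinear with \<open>r\<close> would be collinear
          with \<open>p\<close> or \<open>q\<close>, contrary to their membership in
          \<open>N\<close>.\<close>
        have "\<not> col x r" if x: "x \<in> ?Q" for x
        proof
          assume c: "col x r"
          have "x \<noteq> p" "x \<noteq> q"
            using Ncol[OF x] line_col[OF l] x p q c False line_closedD[OF edge_points_closed[OF g], of p q r]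
              line_closedD[OF edge_points_closed[OF g]] unfolding N_def by blast+
          moreover have "x \<noteq> r" using col_neq[OF c] .
          ultimately show False
            using line_parity[OF l, of x] c Ncol[OF x p] Ncol[OF x q] by auto
        qed
        then show ?thesis using line_points[OF l] col_sym unfolding N_def by blast
      qed simp
      have "line_closed L (?Q \<union> N)"
        unfolding line_closed_def
      proof (intro allI impI)
        fix p q r assume l: "{p, q, r} \<in> L" "p \<in> ?Q \<union> N" "q \<in> ?Q \<union> N"
        have "col p q" "col q p" using line_col[OF l(1)] by auto
        then consider "p \<in> ?Q" "q \<in> ?Q" | "p \<in> N" "q \<in> N" using l Ncol by blast
        then show "r \<in> ?Q \<union> N"
          using line_closedD[OF edge_points_closed[OF g] l(1)] third_N[OF l(1)] by cases auto
      qed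
      moreover have "S \<subseteq> ?Q \<union> N" using gen(1) none unfolding N_def by blast
      moreover have "?Q \<union> N \<subseteq> P" using edge_points_subset[OF g] unfolding N_def by blast
      ultimately have all: "?Q \<union> N = P" using gen(2) by blast
      have "g 1 2 \<in> ?Q" using edge_in_points[OF g, of 1 2] less.prems(2) by auto
      then have "x \<in> ?Q" if "x \<in> P" for x
      proof (rule connected_system_induct[OF connected _ _ _ that, rotated])
        show "g 1 2 \<in> P" using \<open>g 1 2 \<in> ?Q\<close> edge_points_subset[OF g] by blast
        fix x y assume xy: "x \<in> ?Q" "col x y"
        then have "y \<in> ?Q \<union> N" using all col_points(2) by blast
        then show "y \<in> ?Q" using Ncol xy by blast
      qed
      then show False using notsub gen(1) by blast
    qed
    then obtain s p where s: "s \<in> S" "s \<notin> ?Q" "p \<in> ?Q" "col s p" by blast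
    then obtain g' where g': "edge_labelling (Suc m) g'" "?Q \<subseteq> edge_points (Suc m) g'"
      "s \<in> edge_points (Suc m) g'"
      using edge_extend[OF g _ s(2) s(3,4)] gen(1) by blast
    have "S - edge_points (Suc m) g' \<subset> S - ?Q" using g' s by blast
    then have lt: "card (S - edge_points (Suc m) g') < card (S - ?Q)"
      using assms(3) by (intro psubset_card_mono) auto
    from less.hyps[OF lt g'(1)] less.prems(2) obtain m' h where
      "edge_labelling m' h" "edge_points m' h = P" "2 \<le> m'" "m' \<le> Suc m + card (S - edge_points (Suc m) g')"
      by auto
    then show ?thesis using lt by (intro exI[of _ m'] exI[of _ h]) auto
  qed
qed

text \<open>Two estimates meet: one labelled generator and \<open>n - 1\<close> extensions give at
  most \<open>n + 1\<close> vertices, while the \<open>m - 1\<close> edges at vertex 1 generate, so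
  that \<open>n \<le> m - 1\<close>.\<close>

lemma has_rank_edge_labelling:
  assumes n: "n > 0" and rank: "has_rank P L n"
  obtains g where "edge_labelling (n + 1) g" "edge_points (n + 1) g = P"
proof -
  obtain S where S: "S \<subseteq> P" "finite S" "card S = n" "generated_subsystem P L S P L"
    using rank unfolding has_rank_def by blast
  obtain p where p: "p \<in> S" using S n by fastforce
  \<comment> \<open>Two vertices have a single edge, so a constant function is a labelling and the
    conditions on triangles and disjoint edges are vacuous.\<close>
  have base: "edge_labelling 2 (\<lambda>_ _. p)" unfolding edge_labelling_def using p S(1) by auto
  have "p \<in> edge_points 2 (\<lambda>_ _. p)"
    unfolding edge_points_def by (intro CollectI exI[of _ 1] exI[of _ 2]) simp
  then have "edge_points 2 (\<lambda>_ _. p) = {p}" unfolding edge_points_def by blast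
  then have "card (S - edge_points 2 (\<lambda>_ _. p)) = n - 1" using p S by simp
  then obtain m g where g: "edge_labelling m g" and P: "edge_points m g = P" and m: "2 \<le> m" "m \<le> 2 + (n - 1)"
    using edge_exhaust[OF base _ S(2,4)] by auto
  let ?T = "g 1 ` {2..m}"
  have "generated_subsystem P L ?T P L"
    unfolding generates_iff
  proof (intro conjI allI impI)
    show "?T \<subseteq> P" using edge_in_P[OF g] by auto
    fix Q assume Q: "Q \<subseteq> P" "line_closed L Q" "?T \<subseteq> Q"
    have "g i j \<in> Q" if V: "i \<in> {1..m}" "j \<in> {1..m}" "i \<noteq> j" for i j
    proof -
      have T: "g 1 k \<in> Q" if "k \<in> {1..m}" "k \<noteq> 1" for k using Q(3) that by auto
      consider "i = 1" | "j = 1" | "i \<noteq> 1" "j \<noteq> 1" by blast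
      then show ?thesis
      proof cases
        case 3
        have "{g 1 i, g 1 j, g i j} \<in> L"
          using edge_line[OF g, of 1 i j] 3 V m by (auto simp: insert_commute)
        then show ?thesis using line_closedD[OF Q(2)] T 3 V by blast
      qed (use T[of i] T[of j] V edge_sym[OF g, of i j] in auto)
    qed
    then show "Q = P" using Q(1) P unfolding edge_points_def by blast
  qed
  moreover have "?T \<subseteq> P" "finite ?T" using edge_in_P[OF g] by auto
  ultimately have "n \<le> card ?T" using rank unfolding has_rank_def by blast
  also have "card ?T \<le> card {2..m}" by (rule card_image_le) simp
  finally have "m = n + 1" using m n by simp
  then show thesis using that g P by blast
qed

end

section \<open>The Fischer space of the symmetric group\<close>

lemma transpose_eq_iff_doubleton:
  assumes "i \<noteq> j" "k \<noteq> l"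
  shows "transpose i j = transpose k l \<longleftrightarrow> {i, j} = {k, l}"
proof
  assume e: "transpose i j = transpose k l"
  have "transpose k l i \<noteq> i" "transpose k l j \<noteq> j" using fun_cong[OF e, of i] fun_cong[OF e, of j] assms by auto
  then have "i \<in> {k, l}" "j \<in> {k, l}" by (auto simp: transpose_def split: if_splits)
  then show "{i, j} = {k, l}" using assms by auto
next
  assume "{i, j} = {k, l}"
  then show "transpose i j = transpose k l" by (auto simp: doubleton_eq_iff transpose_commute)
qed

text \<open>Equal transpositions cancel and disjoint ones commute, so a product of order 3 needs
  exactly one common entry; conjugation then yields the third side of the triangle.\<close>

lemma fischer_lines_transpositions:
  "fischer_lines (sym_group m) (transpositions m) =
    {{transpose i j, transpose j k, transpose i k} | i j k.
       i \<in> {1..m} \<and> j \<in> {1..m} \<and> k \<in> {1..m} \<and> i \<noteq> j \<and> j \<noteq> k \<and> i \<noteq> k}"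
    (is "_ = ?R")
proof -
  interpret group "sym_group m" by (rule sym_group_is_group)
  note sym = sym_group_mult sym_group_one sym_group_carrier
  have car: "transpose i j \<in> carrier (sym_group m)" if "i \<in> {1..m}" "j \<in> {1..m}" for i j
    using that by (simp add: sym permutes_swap_id)
  have inv: "inv\<^bsub>sym_group m\<^esub> (transpose i j) = transpose i j" if "i \<in> {1..m}" "j \<in> {1..m}" for i j
    using that car by (intro inv_equality) (auto simp: sym)
  have conj: "transpose j k \<circ> transpose i j \<circ> transpose j k = transpose i k"
    if "i \<noteq> j" "j \<noteq> k" "i \<noteq> k" for i j k :: nat
    using transpose_comp_triple[of k i j] that by (simp add: transpose_commute)
  have ord3: "ord (transpose i j \<circ> transpose j k) = 3"
    if V: "i \<in> {1..m}" "j \<in> {1..m}" "k \<in> {1..m}" and ne: "i \<noteq> j" "j \<noteq> k" "i \<noteq> k" for i j k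
  proof -
    let ?x = "transpose i j \<circ> transpose j k"
    have x: "?x \<in> carrier (sym_group m)" using m_closed[OF car car] V by (simp add: sym)
    have "?x [^]\<^bsub>sym_group m\<^esub> (3::nat) = ?x \<circ> ?x \<circ> ?x"
      using x by (simp add: numeral_3_eq_3 sym)
    also have "\<dots> = transpose i j \<circ> (transpose j k \<circ> transpose i j \<circ> transpose j k) \<circ> (transpose i j \<circ> transpose j k)"
      by (simp add: comp_assoc)
    also have "\<dots> = (transpose i j \<circ> transpose i k \<circ> transpose i j) \<circ> transpose j k"
      using conj[OF ne] by (simp add: comp_assoc)
    also have "transpose i j \<circ> transpose i k \<circ> transpose i j = transpose j k"
      using conj[of k i j] ne by (simp add: transpose_commute)
    also have "transpose j k \<circ> transpose j k = id" by simp
    finally have "?x [^]\<^bsub>sym_group m\<^esub> (3::nat) = id" .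
    then have "ord ?x dvd 3" using pow_eq_id[OF x] by (simp add: sym)
    moreover have "?x k \<noteq> k" using ne by (simp add: transpose_def)
    then have "?x \<noteq> id" by (metis id_apply)
    then have "ord ?x \<noteq> 1" using ord_eq_1[OF x] by (simp add: sym)
    moreover have "d = 1 \<or> d = 3" if "d dvd 3" for d :: nat
    proof -
      have "d = 0 \<or> d = 1 \<or> d = 2 \<or> d = 3" using dvd_imp_le[OF that] by auto
      then show ?thesis using that by auto
    qed
    ultimately show ?thesis by blast
  qed
  have not3: "\<not> distinct [i, j, k, l] \<and> {i, j} \<noteq> {k, l}"
    if V: "i \<in> {1..m}" "j \<in> {1..m}" "k \<in> {1..m}" "l \<in> {1..m}" and o: "ord (transpose i j \<circ> transpose k l) = 3"
    for i j k l
  proof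
    let ?x = "transpose i j \<circ> transpose k l"
    have x: "?x \<in> carrier (sym_group m)" using m_closed[OF car car] V by (simp add: sym)
    show "\<not> distinct [i, j, k, l]"
    proof
      assume d: "distinct [i, j, k, l]"
      have "(?x \<circ> ?x) z = z" for z using d by (auto simp: transpose_def)
      then have "?x \<circ> ?x = id" by (simp add: fun_eq_iff)
      then have "?x [^]\<^bsub>sym_group m\<^esub> (2::nat) = id" using x by (simp add: numeral_2_eq_2 sym)
      then have "ord ?x dvd 2" using pow_eq_id[OF x] by (simp add: sym)
      then show False using o by simp
    qed
    show "{i, j} \<noteq> {k, l}"
    proof
      assume "{i, j} = {k, l}"
      then have "?x = id" by (auto simp: doubleton_eq_iff transpose_commute)
      then have "ord ?x = 1" using ord_eq_1[OF x] by (simp add: sym)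
      then show False using o by simp
    qed
  qed
  show ?thesis
  proof (intro equalityI subsetI)
    fix X assume "X \<in> fischer_lines (sym_group m) (transpositions m)"
    then obtain c d where cd: "c \<in> transpositions m" "d \<in> transpositions m" "ord (c \<circ> d) = 3"
      "X = {c, d, inv\<^bsub>sym_group m\<^esub> d \<circ> c \<circ> d}"
      unfolding fischer_lines_def by (auto simp: sym)
    obtain i j where c: "i \<in> {1..m}" "j \<in> {1..m}" "i \<noteq> j" "c = transpose i j"
      using cd(1) unfolding transpositions_def by auto
    obtain k l where d: "k \<in> {1..m}" "l \<in> {1..m}" "k \<noteq> l" "d = transpose k l"
      using cd(2) unfolding transpositions_def by auto
    have "\<not> distinct [i, j, k, l] \<and> {i, j} \<noteq> {k, l}" using not3[of i j k l] cd c d by auto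
    then have "\<exists>a b e. {a, b, e} \<subseteq> {1..m} \<and> a \<noteq> b \<and> b \<noteq> e \<and> a \<noteq> e \<and> {i, j} = {a, b} \<and> {k, l} = {b, e}"
      using c d by (auto simp: doubleton_eq_iff)
    then obtain a b e where abe: "a \<in> {1..m}" "b \<in> {1..m}" "e \<in> {1..m}" "a \<noteq> b" "b \<noteq> e" "a \<noteq> e"
      "c = transpose a b" "d = transpose b e"
      using c d transpose_eq_iff_doubleton by (metis insert_subset)
    then have "X = {transpose a b, transpose b e, transpose a e}" using cd(4) inv conj by simp
    then show "X \<in> ?R" using abe by blast
  next
    fix X assume "X \<in> ?R"
    then obtain i j k where V: "i \<in> {1..m}" "j \<in> {1..m}" "k \<in> {1..m}" and ne: "i \<noteq> j" "j \<noteq> k" "i \<noteq> k"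
      and X: "X = {transpose i j, transpose j k, transpose i k}" by blast
    have "X = {transpose i j, transpose j k, inv\<^bsub>sym_group m\<^esub> (transpose j k) \<circ> transpose i j \<circ> transpose j k}"
      using X inv V conj[OF ne] by simp
    moreover have "transpose i j \<in> transpositions m" "transpose j k \<in> transpositions m"
      using V ne unfolding transpositions_def by blast+
    ultimately show "X \<in> fischer_lines (sym_group m) (transpositions m)"
      unfolding fischer_lines_def sym_group_mult using ord3[OF V ne] by blast
  qed
qed

lemma (in pts) edge_labelling_isomorphic:
  assumes g: "edge_labelling m g" and P: "edge_points m g = P"
  shows "isomorphic_systems P L (transpositions m) (fischer_lines (sym_group m) (transpositions m))"
proof -
  let ?V = "{1..m}"
  \<comment> \<open>The choice is harmless: \<open>g\<close> determines the edge up to order, and a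
    transposition ignores order.\<close>
  define f where "f p = (SOME e. \<exists>i j. i \<in> ?V \<and> j \<in> ?V \<and> i \<noteq> j \<and> p = g i j \<and> e = transpose i j)" for p
  have f: "f (g i j) = transpose i j" if "i \<in> ?V" "j \<in> ?V" "i \<noteq> j" for i j
    unfolding f_def
  proof (rule some_equality)
    fix e assume "\<exists>k l. k \<in> ?V \<and> l \<in> ?V \<and> k \<noteq> l \<and> g i j = g k l \<and> e = transpose k l"
    then show "e = transpose i j"
      using edge_eq_iff[OF g that] transpose_eq_iff_doubleton[OF that(3)] by metis
  qed (use that in blast)
  have "inj_on f P"
  proof (rule inj_onI)
    fix p q assume "p \<in> P" "q \<in> P" and e: "f p = f q"
    then obtain i j k l where "i \<in> ?V" "j \<in> ?V" "i \<noteq> j" "p = g i j" "k \<in> ?V" "l \<in> ?V" "k \<noteq> l" "q = g k l"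
      using edge_pointsE[OF g] P by metis
    then show "p = q" using e f edge_eq_iff[OF g] transpose_eq_iff_doubleton by metis
  qed
  moreover have "f ` P = transpositions m"
  proof (intro equalityI subsetI)
    fix x assume "x \<in> f ` P"
    then obtain i j where "i \<in> ?V" "j \<in> ?V" "i \<noteq> j" "x = f (g i j)" using edge_pointsE[OF g] P by (metis imageE)
    then show "x \<in> transpositions m" using f unfolding transpositions_def by auto
  next
    fix x assume "x \<in> transpositions m"
    then obtain i j where V: "i \<in> ?V" "j \<in> ?V" "i \<noteq> j" "x = transpose i j" unfolding transpositions_def by blast
    then show "x \<in> f ` P" using f[OF V(1-3)] edge_in_P[OF g V(1-3)] by (metis imageI)
  qed
  ultimately have bij: "bij_betw f P (transpositions m)" by (simp add: bij_betw_def)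
  have tri: "f ` {g i j, g j k, g i k} = {transpose i j, transpose j k, transpose i k}"
    if "i \<in> ?V" "j \<in> ?V" "k \<in> ?V" "i \<noteq> j" "j \<noteq> k" "i \<noteq> k" for i j k
    using f that by simp
  have "(\<lambda>l. f ` l) ` L = fischer_lines (sym_group m) (transpositions m)"
    unfolding fischer_lines_transpositions
  proof (intro equalityI subsetI)
    fix X assume "X \<in> (\<lambda>l. f ` l) ` L"
    then obtain l where l: "l \<in> L" "X = f ` l" by blast
    obtain p q r where pqr: "l = {p, q, r}" using lineE[OF l(1)] .
    then have "p \<in> edge_points m g" "q \<in> edge_points m g" using line_points l(1) P by blast+
    then obtain i j k where V: "i \<in> ?V" "j \<in> ?V" "k \<in> ?V" "i \<noteq> j" "j \<noteq> k" "i \<noteq> k"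
      and "p = g i j" "q = g j k" "r = g i k"
      using edge_line_cases[OF g, of p q r] l(1) pqr by metis
    then have "X = {transpose i j, transpose j k, transpose i k}" using tri[OF V] l(2) pqr by simp
    then show "X \<in> {{transpose i j, transpose j k, transpose i k} | i j k.
       i \<in> {1..m} \<and> j \<in> {1..m} \<and> k \<in> {1..m} \<and> i \<noteq> j \<and> j \<noteq> k \<and> i \<noteq> k}" using V by blast
  next
    fix X assume "X \<in> {{transpose i j, transpose j k, transpose i k} | i j k.
       i \<in> {1..m} \<and> j \<in> {1..m} \<and> k \<in> {1..m} \<and> i \<noteq> j \<and> j \<noteq> k \<and> i \<noteq> k}"
    then obtain i j k where V: "i \<in> ?V" "j \<in> ?V" "k \<in> ?V" "i \<noteq> j" "j \<noteq> k" "i \<noteq> k"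
      and "X = {transpose i j, transpose j k, transpose i k}" by blast
    then show "X \<in> (\<lambda>l. f ` l) ` L" using tri[OF V] edge_line[OF g V] by (metis imageI)
  qed
  then show ?thesis by (rule isomorphic_systemsI[OF bij]) (use line_subset in auto)
qed

section \<open>Fischer spaces with an affine plane\<close>

lemma three_cases: "(c::3) = 0 \<or> c = 1 \<or> c = 2"
proof (cases c)
  case (of_int z)
  then have "z = 0 \<or> z = 1 \<or> z = 2" by auto
  then show ?thesis using of_int by auto
qed

text \<open>Two distinct residues modulo 3 and minus their sum exhaust all three; in
  \<open>comb_inj\<close> this finds prescribed coordinates on a line.\<close>

lemma three_distinct:
  fixes c d :: 3
  assumes "c \<noteq> d"
  shows "0 \<in> {c, d, - c - d}" "1 \<in> {c, d, - c - d}"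
  using three_cases[of c] three_cases[of d] assms by (elim disjE; simp)+

section \<open>The third-point operation and its laws\<close>

locale jordan_affine_fischer = jordan_fischer P L \<delta> for P :: "'a set" and L and \<delta> :: "'f::field" +
  assumes affine_plane: "\<exists>Q. affine_plane Q"
begin

text \<open>The value \<open>x\<close> on the diagonal agrees with \<open>-x - y\<close> modulo 3,
  so in coordinates one formula covers all pairs, and \<open>ax_prod\<close> needs no case for equal
  points.\<close>

definition star :: "'a \<Rightarrow> 'a \<Rightarrow> 'a" (infixl "\<star>" 75) where
  "x \<star> y = (if x = y then x else third x y)"

lemma all_col: "p \<in> P \<Longrightarrow> q \<in> P \<Longrightarrow> p \<noteq> q \<Longrightarrow> col p q"
  using affine_plane affine_plane_all_collinear by blast

lemma star_line: "p \<in> P \<Longrightarrow> q \<in> P \<Longrightarrow> p \<noteq> q \<Longrightarrow> {p, q, p \<star> q} \<in> L"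
  using third_line[OF all_col] by (simp add: star_def)

lemma star_eq: "{p, q, r} \<in> L \<Longrightarrow> p \<star> q = r"
  using third_eq line_distinct by (simp add: star_def)

lemma star_idem [simp]: "x \<star> x = x"
  by (simp add: star_def)

lemma star_commute: "x \<star> y = y \<star> x"
  by (simp add: star_def third_commute)

lemma star_in_P [simp]: "x \<in> P \<Longrightarrow> y \<in> P \<Longrightarrow> x \<star> y \<in> P"
  using line_points(3)[OF star_line] by (cases "x = y") auto

lemma star_star [simp]:
  assumes "x \<in> P" "y \<in> P"
  shows "x \<star> (x \<star> y) = y"
proof (cases "x = y")
  case False
  then have "{x, x \<star> y, y} \<in> L" using star_line[OF assms] by (simp add: insert_commute)
  then show ?thesis by (rule star_eq)
qed simp

lemma star_star' [simp]: "x \<in> P \<Longrightarrow> y \<in> P \<Longrightarrow> y \<star> (x \<star> y) = x" "x \<in> P \<Longrightarrow> y \<in> P \<Longrightarrow> (x \<star> y) \<star> y = x"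
  "x \<in> P \<Longrightarrow> y \<in> P \<Longrightarrow> (x \<star> y) \<star> x = y"
  using star_star star_commute by metis+

lemma star_cancel: "x \<in> P \<Longrightarrow> y \<in> P \<Longrightarrow> z \<in> P \<Longrightarrow> x \<star> y = x \<star> z \<longleftrightarrow> y = z"
  using star_star by metis

text \<open>Three points not on a line span an affine plane, since a dual affine one would contain a
  noncollinear pair; there the law is arithmetic modulo 3. Mediality is stronger and does not follow
  from the planes alone.\<close>

lemma star_distrib:
  assumes P: "x \<in> P" "y \<in> P" "z \<in> P"
  shows "x \<star> (y \<star> z) = (x \<star> y) \<star> (x \<star> z)"
proof -
  consider "x = y" | "x = z" | "z = x \<star> y" | "x \<noteq> y" "x \<noteq> z" "y = z" | "x \<noteq> y" "z \<notin> {x, y, x \<star> y}"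
    by blast
  then show ?thesis
  proof cases
    case 2
    then show ?thesis using star_commute by simp
  next
    case 5
    have l: "{x, y, x \<star> y} \<in> L" using star_line P 5 by blast
    have zc: "col z p" if "p \<in> {x, y, x \<star> y}" for p
    proof (rule all_col)
      show "z \<in> P" "p \<in> P" using P that by auto
      show "z \<noteq> p" using that 5 by blast
    qed
    show ?thesis
    proof (rule line_point_plane[OF l 5(2), of x])
      show "x \<in> {x, y, x \<star> y}" "col z x" using zc by auto
    next
      fix x' y' z' u v assume e: "{x, y, x \<star> y} = {x', y', z'}" and "dual_affine x' y' z' z u v"
      then have "\<not> col z x'" unfolding dual_affine_def by simp
      then show ?thesis using zc e by blast
    next
      fix Q assume Q: "affine_plane Q" "{x, y, x \<star> y} \<subseteq> Q" "z \<in> Q"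
      obtain f where inj: "inj_on f Q" and im: "f ` Q = affine_points 2"
        and f: "\<And>p q. p \<in> Q \<Longrightarrow> q \<in> Q \<Longrightarrow> p \<noteq> q \<Longrightarrow> col p q \<and> third p q \<in> Q \<and> f (third p q) = - f p - f q"
        using affine_plane_coordinates[OF Q(1)] by blast
      have tor: "- a - a = a" for a :: "nat \<Rightarrow> 3"
      proof -
        have "- a - a = - (a + a)" by (simp add: algebra_simps)
        then show ?thesis unfolding three_torsion_fun by simp
      qed
      have s: "p \<star> q \<in> Q \<and> f (p \<star> q) = - f p - f q" if "p \<in> Q" "q \<in> Q" for p q
        using f[OF that] that tor by (auto simp: star_def)
      have mem: "x \<in> Q" "y \<in> Q" "z \<in> Q" using Q by auto
      have "f (x \<star> (y \<star> z)) = - f x - (- f y - f z)" using s mem by simp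
      also have "\<dots> = - (- f x - f y) - (- f x - f z) - (f x + f x + f x)" by (simp add: algebra_simps)
      also have "f x + f x + f x = 0" unfolding three_torsion_fun by simp
      also have "- (- f x - f y) - (- f x - f z) - 0 = f ((x \<star> y) \<star> (x \<star> z))" using s mem by simp
      finally show ?thesis using inj s mem by (meson inj_onD)
    qed
  qed (use P in auto)
qed

lemma ax_prod: "p \<in> P \<Longrightarrow> q \<in> P \<Longrightarrow> ax p \<bullet> ax q = ax p + ax q - ax (p \<star> q)"
  using ax_self ax_line[OF star_line] by (cases "p = q") auto

lemma ax_inj: "ax p = ax q \<Longrightarrow> p = q"
  by (metis lookup_axis zero_neq_one)

text \<open>When both sides are expanded, all axes except those of products of all four points occur
  equally often on either side and cancel.\<close>

lemma polarized_star:
  assumes P: "p \<in> P" "q \<in> P" "s \<in> P" "t \<in> P"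
  shows "ax (s \<star> ((p \<star> q) \<star> t)) + ax (p \<star> ((q \<star> s) \<star> t)) + ax (q \<star> ((s \<star> p) \<star> t)) =
    ax ((p \<star> q) \<star> (s \<star> t)) + ax ((q \<star> s) \<star> (p \<star> t)) + ax ((s \<star> p) \<star> (q \<star> t))"
  using polarized_jordan[OF P]
  by (simp add: ax_prod P matsuo_mult_bilinear star_commute[of q p] star_commute[of s q] star_commute[of p s]
      star_commute[of "p \<star> q" s] star_commute[of "q \<star> s" p] star_commute[of "s \<star> p" q]) (simp add: algebra_simps)

text \<open>With \<open>t\<close> as the origin, the three products below are the sums \<open>(p + q) + s\<close>,
  \<open>(q + s) + p\<close>, \<open>(s + p) + q\<close>, and \<open>polarized_star\<close> says that their formal sum is invariant
  under negation; this forces associativity.\<close>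

lemma star_medial:
  assumes P: "p \<in> P" "q \<in> P" "s \<in> P" "t \<in> P"
  shows "(p \<star> q) \<star> (s \<star> t) = (s \<star> q) \<star> (p \<star> t)"
proof -
  define A where "A = (p \<star> q) \<star> (s \<star> t)"
  define B where "B = (q \<star> s) \<star> (p \<star> t)"
  define C where "C = (s \<star> p) \<star> (q \<star> t)"
  have mem: "A \<in> P" "B \<in> P" "C \<in> P" unfolding A_def B_def C_def using P by auto
  \<comment> \<open>Multiplication by \<open>t\<close> is negation relative to the origin
    \<open>t\<close>, so the left terms of \<open>polarized_star\<close> are the negatives of the
    right ones.\<close>
  have neg: "t \<star> ((a \<star> b) \<star> (c \<star> t)) = c \<star> ((a \<star> b) \<star> t)" if "a \<in> P" "b \<in> P" "c \<in> P" for a b c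
    using star_distrib[of t "a \<star> b" "c \<star> t"] P that star_commute[of c "(a \<star> b) \<star> t"] star_commute[of t "a \<star> b"]
      by simp
  have sum: "ax A + ax B + ax C = ax (t \<star> A) + ax (t \<star> B) + ax (t \<star> C)"
    using polarized_star[OF P] neg P unfolding A_def B_def C_def by simp
  have zero: "c = a \<star> b" if "(a \<star> b) \<star> (c \<star> t) = t" "a \<in> P" "b \<in> P" "c \<in> P" for a b c
  proof -
    have "(a \<star> b) \<star> ((a \<star> b) \<star> (c \<star> t)) = c \<star> t" using that P by (intro star_star) auto
    then have "t \<star> c = t \<star> (a \<star> b)" using that(1) star_commute by metis
    then show ?thesis using star_cancel that P by simp
  qed
  \<comment> \<open>A vanishing sum means \<open>p + q + s = 0\<close> with \<open>t\<close> as
    origin, a relation symmetric in the three points, so the other orders of summing vanish as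
    well.\<close>
  have AB: "A = B" if "A = t \<or> B = t \<or> C = t"
  proof -
    have "s = p \<star> q \<or> p = q \<star> s \<or> q = s \<star> p" using that zero P unfolding A_def B_def C_def by blast
    then have s: "s = p \<star> q" using P star_star star_star' star_commute by metis
    have "A = t" unfolding A_def s using P by simp
    moreover have "B = t" unfolding B_def s using P by simp
    ultimately show ?thesis by simp
  qed
  have fixed: "X = t" if "X = t \<star> X" "X \<in> P" for X
    using that P star_star' star_idem star_commute by metis
  have "A = B"
  proof (rule ccontr)
    assume ne: "A \<noteq> B"
    \<comment> \<open>As \<open>A\<close> differs from \<open>B\<close>, its coefficient in the
      formal sum is 1 or 2, which is nonzero in the field; so \<open>A\<close> occurs among the
      negatives.\<close>
    have "A \<in> {t \<star> A, t \<star> B, t \<star> C}"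
    proof (rule ccontr)
      assume "A \<notin> {t \<star> A, t \<star> B, t \<star> C}"
      then have "cf (ax A + ax B + ax C) A = 0" unfolding sum by (auto simp: lookup_add lookup_axis)
      then have "(1::'f) + (if C = A then 1 else 0) = 0" using ne by (simp add: lookup_add lookup_axis)
      moreover have "(2::'f) \<noteq> 0" using char3_two[OF char] by (metis neg_equal_0_iff_equal zero_neq_one)
      ultimately show False by (simp split: if_splits)
    qed
    then consider "A = t \<star> A" | "A = t \<star> B" | "A = t \<star> C" by blast
    then show False
    proof cases
      case 1
      then show False using fixed mem AB ne by blast
    next
      case 2
      \<comment> \<open>The matched terms cancel and leave \<open>C\<close> equal to its own
        negative, hence equal to the origin. The next case does the same with
        \<open>B\<close>.\<close>
      then have "B = t \<star> A" using mem P by simp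
      then have "ax C = ax (t \<star> C)" using sum 2 by simp
      then show False using ax_inj fixed mem AB ne by blast
    next
      case 3
      then have "C = t \<star> A" using mem P by simp
      then have "ax B = ax (t \<star> B)" using sum 3 by (simp add: algebra_simps)
      then show False using ax_inj fixed mem AB ne by blast
    qed
  qed
  then show ?thesis unfolding A_def B_def using star_commute by metis
qed

lemma star_medial': 
  assumes "a \<in> P" "b \<in> P" "c \<in> P" "d \<in> P"
  shows "(a \<star> b) \<star> (c \<star> d) = (a \<star> c) \<star> (b \<star> d)"
  using star_medial[of b a c d] assms star_commute by metis

text \<open>The affine combination of the points \<open>b 0, \<dots>, b k\<close> with coefficients \<open>x\<close>, built with
  \<open>b 0\<close> as origin, where \<open>u + v = b 0 \<star> (u \<star> v)\<close>.\<close>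

definition scal :: "'a \<Rightarrow> 3 \<Rightarrow> 'a \<Rightarrow> 'a" where
  "scal o' c a = (if c = 0 then o' else if c = 1 then a else o' \<star> a)"

fun comb :: "(nat \<Rightarrow> 'a) \<Rightarrow> nat \<Rightarrow> (nat \<Rightarrow> 3) \<Rightarrow> 'a" where
  "comb b 0 x = b 0"
| "comb b (Suc k) x = b 0 \<star> (comb b k x \<star> scal (b 0) (x k) (b (Suc k)))"

section \<open>Coordinates relative to independent points\<close>

lemma scal_in_P [simp]: "o' \<in> P \<Longrightarrow> a \<in> P \<Longrightarrow> scal o' c a \<in> P"
  by (simp add: scal_def)

lemma comb_in_P [simp]: "(\<And>i. i \<le> k \<Longrightarrow> b i \<in> P) \<Longrightarrow> comb b k x \<in> P"
  by (induction k) auto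

lemma comb_cong: "(\<And>i. i < k \<Longrightarrow> x i = y i) \<Longrightarrow> comb b k x = comb b k y"
  by (induction k) auto

lemma scal_star:
  assumes "o' \<in> P" "a \<in> P"
  shows "scal o' c a \<star> scal o' d a = scal o' (- c - d) a"
proof -
  have "o' \<star> a \<star> o' = a" "a \<star> o' = o' \<star> a" "a \<star> (o' \<star> a) = o'" "(o' \<star> a) \<star> a = o'"
    using assms star_commute by auto
  then show ?thesis using three_cases[of c] three_cases[of d] assms
    by (elim disjE) (simp_all add: scal_def)
qed

text \<open>Distributivity moves the origin outside and mediality separates the last summand, so
  \<open>comb\<close> turns the third-point operation on coordinate vectors into the one on
  points.\<close>

lemma comb_star:
  assumes "\<And>i. i \<le> k \<Longrightarrow> b i \<in> P"
  shows "comb b k x \<star> comb b k y = comb b k (- x - y)"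
  using assms
proof (induction k)
  case (Suc k)
  let ?o = "b 0" and ?m = "\<lambda>x. scal (b 0) (x k) (b (Suc k))"
  have P: "?o \<in> P" "b (Suc k) \<in> P" "comb b k x \<in> P" for x using Suc.prems by auto
  have m: "?m x \<in> P" for x using P by simp
  have "comb b (Suc k) x \<star> comb b (Suc k) y = ?o \<star> ((comb b k x \<star> ?m x) \<star> (comb b k y \<star> ?m y))"
    using star_distrib[of ?o "comb b k x \<star> ?m x" "comb b k y \<star> ?m y"] P m by simp
  also have "\<dots> = ?o \<star> ((comb b k x \<star> comb b k y) \<star> (?m x \<star> ?m y))"
    using star_medial'[of "comb b k x" "?m x" "comb b k y" "?m y"] P m by simp
  also have "comb b k x \<star> comb b k y = comb b k (- x - y)" by (rule Suc.IH) (use Suc.prems in simp)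
  also have "?m x \<star> ?m y = ?m (- x - y)" using scal_star[OF P(1,2)] by simp
  also have "?o \<star> (comb b k (- x - y) \<star> ?m (- x - y)) = comb b (Suc k) (- x - y)" by (simp only: comb.simps)
  finally show ?case .
qed simp

lemma comb_in_closed:
  assumes "line_closed L R" "R \<subseteq> P" "\<And>i. i \<le> k \<Longrightarrow> b i \<in> R"
  shows "comb b k x \<in> R"
  using assms(3)
proof (induction k)
  case (Suc k)
  have star: "p \<star> q \<in> R" if "p \<in> R" "q \<in> R" for p q
    using line_closedD[OF assms(1) star_line] that assms(2) by (cases "p = q") auto
  have "scal (b 0) (x k) (b (Suc k)) \<in> R" using star Suc.prems by (simp add: scal_def)
  moreover have "comb b k x \<in> R" using Suc by simp
  ultimately show ?case using star Suc.prems by simp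
qed auto

lemma comb_range_Suc:
  assumes P: "\<And>i. i \<le> Suc k \<Longrightarrow> b i \<in> P"
  shows "range (comb b k) \<subseteq> range (comb b (Suc k))"
proof
  fix p assume "p \<in> range (comb b k)"
  then obtain x where x: "p = comb b k x" by blast
  have mem: "comb b k x \<in> P" "b 0 \<in> P" using P by auto
  have "comb b (Suc k) (x(k := 0)) = b 0 \<star> (comb b k (x(k := 0)) \<star> b 0)" by (simp add: scal_def)
  also have "comb b k (x(k := 0)) = comb b k x" by (rule comb_cong) simp
  also have "b 0 \<star> (comb b k x \<star> b 0) = p" using mem x by simp
  finally show "p \<in> range (comb b (Suc k))" by (metis rangeI)
qed

lemma comb_zero: "b 0 \<in> P \<Longrightarrow> comb b k (\<lambda>_. 0) = b 0"
  by (induction k) (simp_all add: scal_def)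

lemma comb_range_mem:
  assumes P: "\<And>i. i \<le> k \<Longrightarrow> b i \<in> P" and "j \<le> k"
  shows "b j \<in> range (comb b k)"
  using assms
proof (induction k)
  case 0
  then show ?case by auto
next
  case (Suc k)
  show ?case
  proof (cases "j = Suc k")
    case True
    have mem: "b 0 \<in> P" "b (Suc k) \<in> P" using Suc.prems by auto
    have "comb b k ((\<lambda>_. 0)(k := 1)) = comb b k (\<lambda>_. 0)" by (rule comb_cong) simp
    also have "\<dots> = b 0" using comb_zero mem by simp
    finally have "comb b (Suc k) ((\<lambda>_. 0)(k := 1)) = b 0 \<star> (b 0 \<star> b (Suc k))" by (simp add: scal_def)
    also have "\<dots> = b j" using mem True by simp
    finally show ?thesis by (metis rangeI)
  next
    case False
    then show ?thesis using Suc comb_range_Suc[of k b] by (meson le_SucE le_SucI subsetD)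
  qed
qed

text \<open>If two vectors with equal image differ in the last coordinate, the whole line through
  them has this image. It contains a vector with last coordinate 0 and one with 1, and comparing
  these expresses the last point by earlier ones.\<close>

lemma comb_inj:
  assumes P: "\<And>i. i \<le> m \<Longrightarrow> b i \<in> P" and indep: "\<And>k. k < m \<Longrightarrow> b (Suc k) \<notin> range (comb b k)"
    and "k \<le> m" "comb b k x = comb b k y" "i < k"
  shows "x i = y i"
  using assms(3-5)
proof (induction k arbitrary: x y i)
  case (Suc k)
  let ?o = "b 0" and ?m = "\<lambda>x. scal (b 0) (x k) (b (Suc k))"
  have mem: "?o \<in> P" "b (Suc k) \<in> P" "comb b k x \<in> P" for x using P Suc.prems(1) by auto
  have m: "?m x \<in> P" for x using mem by simp
  have eq: "x k = y k"
  proof (rule ccontr)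
    assume ne: "x k \<noteq> y k"
    define z where "z = - x - y"
    have "comb b (Suc k) z = comb b (Suc k) x \<star> comb b (Suc k) y"
      unfolding z_def by (rule comb_star[symmetric]) (use P Suc.prems(1) in auto)
    then have "comb b (Suc k) z = comb b (Suc k) x" unfolding Suc.prems(2) star_idem .
    then have same: "comb b (Suc k) u = comb b (Suc k) v" if "u \<in> {x, y, z}" "v \<in> {x, y, z}" for u v
      using that Suc.prems(2) by (metis insertE empty_iff)
    have "z k = - x k - y k" by (simp add: z_def)
    then have im: "(\<lambda>u. u k) ` {x, y, z} = {x k, y k, - x k - y k}" by simp
    obtain u where u: "0 = u k" "u \<in> {x, y, z}"
      by (rule imageE[OF three_distinct(1)[OF ne, folded im]])
    obtain v where v: "1 = v k" "v \<in> {x, y, z}"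
      by (rule imageE[OF three_distinct(2)[OF ne, folded im]])
    note uv = u(2) v(2) u(1)[symmetric] v(1)[symmetric]
    have "comb b k u = comb b (Suc k) u" using uv(3) mem by (simp add: scal_def)
    also have "\<dots> = ?o \<star> (comb b k v \<star> b (Suc k))" using same[OF uv(1,2)] uv(4) by (simp add: scal_def)
    \<comment> \<open>Solved for \<open>b (Suc k)\<close>; the origin is itself the combination with
      zero coefficients, so the result lies in the range.\<close>
    finally have "?o \<star> comb b k u = comb b k v \<star> b (Suc k)" using mem by simp
    then have "comb b k v \<star> (?o \<star> comb b k u) = b (Suc k)" using mem by simp
    then have "b (Suc k) = comb b k v \<star> (comb b k (\<lambda>_. 0) \<star> comb b k u)"
      unfolding comb_zero[of b k, OF mem(1)] by (rule sym)
    moreover have "comb b k x \<star> comb b k y = comb b k (- x - y)" for x y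
      by (rule comb_star) (use P Suc.prems(1) in auto)
    ultimately have "b (Suc k) \<in> range (comb b k)" by (metis rangeI)
    then show False using indep Suc.prems(1) by simp
  qed
  then have "comb b k x = comb b k y"
  proof -
    have "?o \<star> (comb b k x \<star> ?m x) = ?o \<star> (comb b k y \<star> ?m x)" using Suc.prems(2) eq by simp
    then have "comb b k x \<star> ?m x = comb b k y \<star> ?m x" using star_cancel mem m by simp
    then have "?m x \<star> comb b k x = ?m x \<star> comb b k y" using star_commute by metis
    then show ?thesis using star_cancel mem m by simp
  qed
  then have "i < k \<Longrightarrow> x i = y i" using Suc.IH Suc.prems(1) by simp
  then show ?case using eq Suc.prems(3) by (cases "i = k") auto
qed simp

text \<open>A minimal generating set is an origin \<open>b 0\<close> with \<open>n - 1\<close>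
  independent directions: a point expressible by earlier ones could be dropped. The combinations
  form a closed set containing the generators, hence are all points.\<close>

lemma has_rank_affine:
  assumes n: "n > 0" and rank: "has_rank P L n"
  shows "isomorphic_systems P L (affine_points (n - 1)) (affine_lines (n - 1))"
proof -
  define m where "m = n - 1"
  obtain S where S: "S \<subseteq> P" "finite S" "card S = n" "generated_subsystem P L S P L"
    using rank unfolding has_rank_def by blast
  obtain b where b: "bij_betw b {0..<n} S" using ex_bij_betw_nat_finite[OF S(2)] S(3) by auto
  have bS: "b i \<in> S" if "i \<le> m" for i using b that n unfolding m_def bij_betw_def by auto
  then have bP: "b i \<in> P" if "i \<le> m" for i using S(1) that by blast
  have Sb: "S = b ` {..m}" using b n unfolding m_def bij_betw_def by (metis Suc_pred' atLeast0LessThan lessThan_Suc_atMost)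
  have gen: "R = P" if "R \<subseteq> P" "line_closed L R" "S \<subseteq> R" for R using S(4) that generates_iff by blast
  have indep: "b (Suc k) \<notin> range (comb b k)" if k: "k < m" for k
  proof
    assume "b (Suc k) \<in> range (comb b k)"
    then obtain x where x: "b (Suc k) = comb b k x" by blast
    let ?T = "S - {b (Suc k)}"
    have "R = P" if R: "R \<subseteq> P" "line_closed L R" "?T \<subseteq> R" for R
    proof -
      have "b i \<in> R" if "i \<le> k" for i
      proof -
        have "Suc k < n" using k unfolding m_def by simp
        then have "b i \<noteq> b (Suc k)"
          using bij_betw_imp_inj_on[OF b, THEN inj_onD, of i "Suc k"] that by auto
        then show ?thesis using R(3) bS[of i] that k by auto
      qed
      then have "b (Suc k) \<in> R" unfolding x using comb_in_closed R by blast
      then show ?thesis using gen R by blast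
    qed
    then have "generated_subsystem P L ?T P L" unfolding generates_iff using S(1) by blast
    then have "n \<le> card ?T" using rank S(1,2) unfolding has_rank_def by (meson Diff_subset finite_Diff subset_trans)
    then show False using S(2,3) bS[of "Suc k"] k n by (simp add: card_Diff_singleton)
  qed
  let ?f = "comb b m"
  have star: "?f x \<star> ?f y = ?f (- x - y)" for x y using comb_star[of m b] bP by blast
  have "line_closed L (range ?f)"
    unfolding line_closed_def
  proof (intro allI impI)
    fix p q r assume l: "{p, q, r} \<in> L" "p \<in> range ?f" "q \<in> range ?f"
    then show "r \<in> range ?f" using star star_eq[OF l(1)] by auto
  qed
  moreover have "S \<subseteq> range ?f" unfolding Sb using comb_range_mem[of m b] bP by blast
  moreover have "range ?f \<subseteq> P" using bP by auto
  ultimately have range: "range ?f = P" using gen by blast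
  have inj: "inj_on ?f (affine_points m)"
  proof (rule inj_onI)
    fix x y assume xy: "x \<in> affine_points m" "y \<in> affine_points m" "?f x = ?f y"
    show "x = y"
    proof
      fix i
      show "x i = y i"
        using comb_inj[OF bP indep order_refl xy(3)] xy(1,2) by (cases "i < m") (auto simp: affine_points_def)
    qed
  qed
  have im: "?f ` affine_points m = P"
  proof
    show "?f ` affine_points m \<subseteq> P" using range by blast
    show "P \<subseteq> ?f ` affine_points m"
    proof
      fix p assume "p \<in> P"
      then obtain x where x: "p = ?f x" using range by blast
      have "?f x = ?f (\<lambda>i. if i < m then x i else 0)" by (rule comb_cong) simp
      moreover have "(\<lambda>i. if i < m then x i else 0) \<in> affine_points m" by (simp add: affine_points_def)
      ultimately show "p \<in> ?f ` affine_points m" using x by auto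
    qed
  qed
  have neg: "(\<lambda>i. - x i - y i) = - x - y" for x y :: "nat \<Rightarrow> 3" by auto
  have "(\<lambda>l. ?f ` l) ` affine_lines m = L"
  proof (intro equalityI subsetI)
    fix l assume "l \<in> (\<lambda>l. ?f ` l) ` affine_lines m"
    then obtain x y where xy: "x \<in> affine_points m" "y \<in> affine_points m" "x \<noteq> y" "l = ?f ` {x, y, - x - y}"
      unfolding affine_lines_def neg by blast
    have "?f x \<noteq> ?f y" using xy inj by (auto dest: inj_onD)
    then have "{?f x, ?f y, ?f x \<star> ?f y} \<in> L" using star_line im xy by blast
    then show "l \<in> L" using xy(4) star by simp
  next
    fix l assume l: "l \<in> L"
    obtain p q r where pqr: "l = {p, q, r}" using lineE[OF l] .
    then obtain x y where xy: "x \<in> affine_points m" "y \<in> affine_points m" "p = ?f x" "q = ?f y"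
      using line_points l im by (metis imageE)
    have "p \<noteq> q" using line_distinct(1) l pqr by blast
    then have "{x, y, - x - y} \<in> affine_lines m" unfolding affine_lines_def neg using xy by blast
    moreover have "?f ` {x, y, - x - y} = l" using star_eq[of p q r] l pqr star xy by simp
    ultimately show "l \<in> (\<lambda>l. ?f ` l) ` affine_lines m" by blast
  qed
  moreover have "affine_lines m \<subseteq> Pow (affine_points m)"
    unfolding affine_lines_def affine_points_def by auto
  ultimately have "isomorphic_systems (affine_points m) (affine_lines m) P L"
    using inj im by (intro isomorphic_systemsI[of ?f]) (auto simp: bij_betw_def)
  then show ?thesis unfolding m_def
    by (rule isomorphic_systems_sym) (auto simp: affine_lines_def affine_points_def)
qed

end

section \<open>Jordan Matsuo algebras from embeddings\<close>

definition linear_extension :: "('f::field \<Rightarrow> 'v::ab_group_add \<Rightarrow> 'v) \<Rightarrow> ('a \<Rightarrow> 'v) \<Rightarrow> ('a \<Rightarrow>\<^sub>0 'f) \<Rightarrow> 'v" where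
  "linear_extension sc \<phi> x = (\<Sum>p\<in>Poly_Mapping.keys x. sc (Poly_Mapping.lookup x p) (\<phi> p))"

context vector_space
begin

lemma linear_extension_superset:
  assumes "finite A" "Poly_Mapping.keys x \<subseteq> A"
  shows "linear_extension scale \<phi> x = (\<Sum>p\<in>A. scale (Poly_Mapping.lookup x p) (\<phi> p))"
  unfolding linear_extension_def using assms
  by (intro sum.mono_neutral_left) (auto simp: not_in_keys_iff_lookup_eq_zero)

lemma linear_extension_add:
  "linear_extension scale \<phi> (x + y) = linear_extension scale \<phi> x + linear_extension scale \<phi> y"
proof -
  let ?A = "Poly_Mapping.keys x \<union> Poly_Mapping.keys y"
  have "Poly_Mapping.keys (x + y) \<subseteq> ?A" by (rule keys_add)
  then show ?thesis
    by (subst (1 2 3) linear_extension_superset[where A = ?A])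
      (auto simp: lookup_add scale_left_distrib sum.distrib)
qed

lemma linear_extension_scale:
  "linear_extension scale \<phi> (pm_scale c x) = scale c (linear_extension scale \<phi> x)"
proof -
  have "Poly_Mapping.keys (pm_scale c x) \<subseteq> Poly_Mapping.keys x" by (auto simp: in_keys_iff)
  then show ?thesis
    by (subst linear_extension_superset[where A = "Poly_Mapping.keys x"])
      (auto simp: linear_extension_def scale_sum_right)
qed

lemma linear_extension_axis: "linear_extension scale \<phi> (axis p) = \<phi> p"
  by (simp add: linear_extension_def axis_def)

end

lemma matsuo_carrier_induct [consumes 1, case_names zero add]:
  fixes x :: "'a \<Rightarrow>\<^sub>0 'f::field"
  assumes x: "x \<in> matsuo_carrier P" and zero: "Q 0"
    and add: "\<And>c p y. p \<in> P \<Longrightarrow> Q y \<Longrightarrow> Q (pm_scale c (axis p) + y)"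
  shows "Q x"
proof -
  have "Q (\<Sum>p\<in>A. pm_scale (Poly_Mapping.lookup x p) (axis p))" if "finite A" "A \<subseteq> P" for A
    using that by (induction A rule: finite_induct) (auto intro: zero add)
  then have "Q (\<Sum>p\<in>Poly_Mapping.keys x. pm_scale (Poly_Mapping.lookup x p) (axis p))"
    using x unfolding matsuo_carrier_def by simp
  moreover have "(\<Sum>p\<in>Poly_Mapping.keys x. pm_scale (Poly_Mapping.lookup x p) (axis p)) = x"
    by (rule poly_mapping_eqI)
      (simp add: lookup_sum lookup_axis if_distrib[of "\<lambda>u. _ * u"] not_in_keys_iff_lookup_eq_zero cong: if_cong)
  ultimately show ?thesis by simp
qed

text \<open>Multiplicativity needs checking only on axes because it is bilinear. The Jordan identity
  is cubic in one variable and is therefore demanded of all elements of the target and pulled back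
  along the injection.\<close>

lemma (in pts) jordan_algebra_transfer:
  fixes sc :: "'f::field \<Rightarrow> 'v::ab_group_add \<Rightarrow> 'v" and B :: "'v \<Rightarrow> 'v \<Rightarrow> 'v"
  assumes sc: "vector_space sc"
    and B_add: "\<And>a b c. B (a + b) c = B a c + B b c" "\<And>a b c. B a (b + c) = B a b + B a c"
    and B_scale: "\<And>k a b. B (sc k a) b = sc k (B a b)" "\<And>k a b. B a (sc k b) = sc k (B a b)"
    and B_jordan: "\<And>a b. B (B (B a a) b) a = B (B a a) (B b a)"
    and basis: "\<And>p q. p \<in> P \<Longrightarrow> q \<in> P \<Longrightarrow>
      linear_extension sc \<phi> (axis_mult L \<delta> p q) = B (\<phi> p) (\<phi> q)"
    and inj: "\<And>x. x \<in> matsuo_carrier P \<Longrightarrow> linear_extension sc \<phi> x = 0 \<Longrightarrow> x = 0"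
  shows "jordan_algebra pm_scale (matsuo_carrier P) (matsuo_mult L \<delta>)"
proof -
  interpret V: vector_space sc by fact
  interpret W: vector_space "pm_scale :: 'f \<Rightarrow> ('a \<Rightarrow>\<^sub>0 'f) \<Rightarrow> _" by (rule vector_space_pm_scale)
  let ?F = "linear_extension sc \<phi>" and ?M = "matsuo_mult L \<delta>" and ?A = "matsuo_carrier P :: ('a \<Rightarrow>\<^sub>0 'f) set"
  note lin = V.linear_extension_add V.linear_extension_scale V.linear_extension_axis
  have zero: "?F 0 = 0" by (simp add: linear_extension_def)
  have Bzero: "B 0 c = 0" "B c 0 = 0" for c
    using B_add(1)[of 0 0 c] B_add(2)[of c 0 0] by auto
  have hom1: "?F (?M x (axis q)) = B (?F x) (\<phi> q)" if "x \<in> ?A" "q \<in> P" for x q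
    using that(1)
    by (induction rule: matsuo_carrier_induct)
      (simp_all add: zero Bzero matsuo_mult_add_left matsuo_mult_scale_left matsuo_mult_axis lin B_add B_scale basis that(2))
  have hom: "?F (?M x y) = B (?F x) (?F y)" if "x \<in> ?A" "y \<in> ?A" for x y
    using that(2)
    by (induction rule: matsuo_carrier_induct)
      (simp_all add: zero Bzero matsuo_mult_add_right matsuo_mult_scale_right lin B_add B_scale hom1 that(1))
  have "?M (?M (?M a a) b) a = ?M (?M a a) (?M b a)" if ab: "a \<in> ?A" "b \<in> ?A" for a b
  proof -
    let ?l = "?M (?M (?M a a) b) a" and ?r = "?M (?M a a) (?M b a)"
    have mem: "?l \<in> ?A" "?r \<in> ?A" using ab matsuo_mult_in_carrier by blast+
    have "?F ?l = ?F ?r" using ab by (simp add: hom matsuo_mult_in_carrier B_jordan)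
    moreover have "?F ?l = ?F (?l - ?r) + ?F ?r" unfolding lin(1)[symmetric] by simp
    ultimately have "?F (?l - ?r) = 0" by simp
    moreover have "?l - ?r \<in> ?A" using W.subspace_diff[OF subspace_matsuo_carrier mem] .
    ultimately have "?l - ?r = 0" using inj by blast
    then show ?thesis by simp
  qed
  then show ?thesis unfolding matsuo_jordan_iff by blast
qed

subsection \<open>Affine spaces\<close>

text \<open>In the group algebra of \<open>V = (\<int>/3)\<^sup>m\<close>, with \<open>E\<close> the augmentation and \<open>S\<close> induced by negation, \<open>B\<close> is the
  product of the Matsuo algebra, and every cube is a scalar because the Frobenius map is additive.\<close>

lemma augmented_ring_jordan:
  fixes E S :: "'r::comm_ring_1 \<Rightarrow> 'r"
  assumes E: "\<And>x y. E (x + y) = E x + E y" "\<And>x y. E (x * y) = E x * E y" "\<And>x. E (E x) = E x"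
      "\<And>x. E (S x) = E x"
    and S: "\<And>x y. S (x + y) = S x + S y" "\<And>x y. S (x * y) = S x * S y" "\<And>x. S (S x) = x" "\<And>x. S (E x) = E x"
    and cube: "\<And>x. S (x * x * x) = x * x * x"
  defines "B \<equiv> \<lambda>a b. E b * a + E a * b - S (a * b)"
  shows "B (B (B a a) b) a = B (B a a) (B b a)"
proof -
  have Em: "E (x - y) = E x - E y" and Sm: "S (x - y) = S x - S y" for x y
    using E(1)[of "x - y" y] S(1)[of "x - y" y] by (simp_all add: algebra_simps)
  \<comment> \<open>All other terms agree once \<open>E\<close> and \<open>S\<close> are pushed
    inward; the obstruction is the failure of the cube of \<open>a\<close> to be fixed by
    \<open>S\<close>.\<close>
  have "B (B (B a a) b) a = B (B a a) (B b a) + (a * a * a - S a * S a * S a) * b"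
    unfolding B_def E S Em Sm by (simp add: algebra_simps)
  also have "S a * S a * S a = a * a * a" using cube[of a] by (simp add: S)
  finally show ?thesis by simp
qed

lemma pm_scale_mult:
  fixes x y :: "'k::comm_monoid_add \<Rightarrow>\<^sub>0 'f::field"
  shows "pm_scale c x * y = pm_scale c (x * y)" "x * pm_scale c y = pm_scale c (x * y)"
  unfolding pm_scale_def mult_map_scale_conv_mult by (simp_all add: ac_simps)

lemma axis_mult_axis: "axis u * axis v = (axis (u + v) :: 'k::comm_monoid_add \<Rightarrow>\<^sub>0 'f::field)"
  unfolding axis_def by (simp add: mult_single)

lemma (in pts) affine_jordan:
  fixes \<delta> :: "'f::field"
  assumes char: "CHAR('f) = 3" and \<delta>: "\<delta> = 1 / 4"
    and iso: "isomorphic_systems P L (affine_points m) (affine_lines m)"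
  shows "jordan_algebra pm_scale (matsuo_carrier P) (matsuo_mult L \<delta>)"
proof -
  have "L \<subseteq> Pow P" using line_subset by blast
  then obtain f where f: "bij_betw f P (affine_points m)"
    "\<And>p q r. p \<in> P \<Longrightarrow> q \<in> P \<Longrightarrow> r \<in> P \<Longrightarrow> {f p, f q, f r} \<in> affine_lines m \<longleftrightarrow> {p, q, r} \<in> L"
    using isomorphic_systemsE[OF iso] by metis
  have inj: "inj_on f P" and im: "f ` P = affine_points m" using f(1) by (auto simp: bij_betw_def)
  interpret V: vector_space "pm_scale :: 'f \<Rightarrow> ((nat \<Rightarrow> 3) \<Rightarrow>\<^sub>0 'f) \<Rightarrow> _" by (rule vector_space_pm_scale)
  \<comment> \<open>The augmentation takes values in the multiples of 1 inside the group algebra, so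
    that \<open>E b * a\<close> is a product in a single ring.\<close>
  define E :: "((nat \<Rightarrow> 3) \<Rightarrow>\<^sub>0 'f) \<Rightarrow> ((nat \<Rightarrow> 3) \<Rightarrow>\<^sub>0 'f)" where "E = linear_extension pm_scale (\<lambda>_. 1)"
  define S :: "((nat \<Rightarrow> 3) \<Rightarrow>\<^sub>0 'f) \<Rightarrow> ((nat \<Rightarrow> 3) \<Rightarrow>\<^sub>0 'f)" where "S = linear_extension pm_scale (\<lambda>v. axis (- v))"
  have one: "1 = (axis 0 :: (nat \<Rightarrow> 3) \<Rightarrow>\<^sub>0 'f)" by (simp add: axis_def)
  have E: "E (x + y) = E x + E y" "E (pm_scale c x) = pm_scale c (E x)" "E (axis v) = 1" "E 1 = 1" for x y c v
    unfolding E_def V.linear_extension_add V.linear_extension_scale one V.linear_extension_axis by simp_all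
  have S: "S (x + y) = S x + S y" "S (pm_scale c x) = pm_scale c (S x)" "S (axis v) = axis (- v)" "S 1 = 1" for x y c v
    unfolding S_def V.linear_extension_add V.linear_extension_scale one V.linear_extension_axis by simp_all
  have zero: "E 0 = 0" "S 0 = 0" by (simp_all add: E_def S_def linear_extension_def)
  have univ: "x \<in> matsuo_carrier UNIV" for x :: "(nat \<Rightarrow> 3) \<Rightarrow>\<^sub>0 'f" by (simp add: matsuo_carrier_def)
  note scale_simps = pm_scale_mult V.scale_right_distrib distrib_left distrib_right
  have E1: "E (axis v * y) = E y" for v y
    using univ[of y] by (induction rule: matsuo_carrier_induct)
      (simp_all add: zero E scale_simps axis_mult_axis)
  have E2: "E (x * y) = E x * E y" for x y
    using univ[of x] by (induction rule: matsuo_carrier_induct) (simp_all add: zero E E1 scale_simps)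
  have S1: "S (axis v * y) = axis (- v) * S y" for v y
    using univ[of y]
  proof (induction rule: matsuo_carrier_induct)
    case (add c p y)
    have "- (v + p) = - v + - p" by (rule minus_add_distrib)
    then show ?case by (simp only: distrib_left S(1-3) pm_scale_mult axis_mult_axis add.IH)
  qed (simp add: zero)
  have S2: "S (x * y) = S x * S y" for x y
    using univ[of x] by (induction rule: matsuo_carrier_induct) (simp_all add: zero S S1 scale_simps)
  have E3: "E (E x) = E x" and E4: "E (S x) = E x" and S3: "S (S x) = x" and S4: "S (E x) = E x" for x
    using univ[of x] by (induction rule: matsuo_carrier_induct; simp add: zero E S)+
  have three: "(3 :: (nat \<Rightarrow> 3) \<Rightarrow>\<^sub>0 'f) = 0"
    using char3[OF char] by (metis single_numeral single_zero)
  have tor: "- v - v = v" and tor3: "v + v + v = 0" for v :: "nat \<Rightarrow> 3"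
  proof -
    have "- v - v = - (v + v)" by (simp add: algebra_simps)
    then show "- v - v = v" unfolding three_torsion_fun by simp
    show "v + v + v = 0" unfolding three_torsion_fun by simp
  qed
  have cube: "S (x * x * x) = x * x * x" for x
    using univ[of x]
  proof (induction rule: matsuo_carrier_induct)
    case (add c v y)
    let ?u = "pm_scale c (axis v) :: (nat \<Rightarrow> 3) \<Rightarrow>\<^sub>0 'f"
    have "(?u + y) * (?u + y) * (?u + y) = ?u * ?u * ?u + y * y * y + 3 * (?u * ?u * y + ?u * y * y)"
      by (simp add: algebra_simps)
    then have e: "(?u + y) * (?u + y) * (?u + y) = ?u * ?u * ?u + y * y * y" unfolding three by simp
    \<comment> \<open>Three times a vector is zero, so the cube of a scaled basis element is a
      multiple of the unit and is fixed by negation.\<close>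
    have "?u * ?u * ?u = pm_scale c (pm_scale c (pm_scale c (axis 0)))"
      by (simp only: pm_scale_mult axis_mult_axis tor3)
    then have "S (?u * ?u * ?u) = ?u * ?u * ?u" by (simp only: S minus_zero)
    then show ?case unfolding e S(1) add.IH by simp
  qed (simp add: zero)
  define B where "B a b = E b * a + E a * b - S (a * b)" for a b
  have Sm: "S (x - y) = S x - S y" for x y using S(1)[of "x - y" y] by (simp add: algebra_simps)
  show ?thesis
  proof (rule jordan_algebra_transfer[where sc = pm_scale and B = B and \<phi> = "\<lambda>p. axis (f p)"])
    show "vector_space (pm_scale :: 'f \<Rightarrow> ((nat \<Rightarrow> 3) \<Rightarrow>\<^sub>0 'f) \<Rightarrow> _)" by (rule vector_space_pm_scale)
    show "B (a + b) c = B a c + B b c" "B a (b + c) = B a b + B a c" for a b c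
      unfolding B_def by (simp_all add: E S algebra_simps)
    show "B (pm_scale k a) b = pm_scale k (B a b)" "B a (pm_scale k b) = pm_scale k (B a b)" for k a b
      unfolding B_def by (simp_all add: E S pm_scale_mult V.scale_right_distrib V.scale_right_diff_distrib)
    show "B (B (B a a) b) a = B (B a a) (B b a)" for a b
      unfolding B_def by (rule augmented_ring_jordan) (fact E(1) E2 E3 E4 S(1) S2 S3 S4 cube)+
  next
    fix p q assume pq: "p \<in> P" "q \<in> P"
    let ?F = "linear_extension pm_scale (\<lambda>p. axis (f p)) :: _ \<Rightarrow> ((nat \<Rightarrow> 3) \<Rightarrow>\<^sub>0 'f)"
    have F: "?F (x + y) = ?F x + ?F y" "?F (axis p) = axis (f p)" for x y p
      by (rule V.linear_extension_add, rule V.linear_extension_axis)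
    have Fm: "?F (x - y) = ?F x - ?F y" for x y using F(1)[of "x - y" y] by (simp add: algebra_simps)
    have B: "B (axis (f p)) (axis (f q)) = axis (f p) + axis (f q) - axis (- f p - f q)"
      unfolding B_def by (simp add: E S axis_mult_axis)
    have d1: "\<delta> = 1" using \<delta> char3_quarter[OF char] by simp
    show "?F (axis_mult L \<delta> p q) = B (axis (f p)) (axis (f q))"
    proof (cases "p = q")
      case True
      then show ?thesis unfolding B by (simp add: axis_mult_def F tor)
    next
      case False
      have fpq: "f p \<in> affine_points m" "f q \<in> affine_points m" using pq im by auto
      then have "- f p - f q \<in> affine_points m" by (auto simp: affine_points_def)
      then obtain r where r: "r \<in> P" "f r = - f p - f q" using im by (metis imageE)
      have "f p \<noteq> f q" using False pq inj by (auto dest: inj_onD)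
      moreover have "(\<lambda>i. - f p i - f q i) = - f p - f q" by auto
      ultimately have "{f p, f q, f r} \<in> affine_lines m" unfolding affine_lines_def r(2) using fpq by force
      then have l: "{p, q, r} \<in> L" using f(2) pq r by blast
      then have "axis_mult L \<delta> p q = axis p + axis q - axis r"
        unfolding d1 matsuo_mult_axis[symmetric] by (rule axis_line)
      then show ?thesis unfolding B by (simp add: F Fm r(2))
    qed
  next
    fix x :: "'a \<Rightarrow>\<^sub>0 'f" assume x: "x \<in> matsuo_carrier P" "linear_extension pm_scale (\<lambda>p. axis (f p)) x = 0"
    show "x = 0"
    proof (rule poly_mapping_eqI)
      fix p
      show "Poly_Mapping.lookup x p = Poly_Mapping.lookup 0 p"
      proof (cases "p \<in> Poly_Mapping.keys x")
        case True
        have "(0::'f) = Poly_Mapping.lookup (linear_extension pm_scale (\<lambda>p. axis (f p)) x) (f p)" using x(2) by simp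
        also have "\<dots> = (\<Sum>q\<in>Poly_Mapping.keys x. if q = p then Poly_Mapping.lookup x q else 0)"
          unfolding linear_extension_def lookup_sum
        proof (rule sum.cong)
          fix q assume "q \<in> Poly_Mapping.keys x"
          then have "f q = f p \<longleftrightarrow> q = p"
            using x(1) True by (intro inj_on_eq_iff[OF inj]) (auto simp: matsuo_carrier_def)
          then show "Poly_Mapping.lookup (pm_scale (Poly_Mapping.lookup x q) (axis (f q))) (f p) =
              (if q = p then Poly_Mapping.lookup x q else 0)" by (simp add: lookup_axis)
        qed simp
        also have "\<dots> = Poly_Mapping.lookup x p" using True by simp
        finally show ?thesis by simp
      qed (simp add: not_in_keys_iff_lookup_eq_zero)
    qed
  qed
qed

subsection \<open>Symmetric groups\<close>

text \<open>In characteristic 3 one has 1/2 = -1, so this \<open>B\<close> is there the usual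
  symmetrized product of a special Jordan algebra.\<close>

lemma associative_jordan:
  fixes mul :: "'v::ab_group_add \<Rightarrow> 'v \<Rightarrow> 'v"
  assumes add: "\<And>a b c. mul (a + b) c = mul a c + mul b c" "\<And>a b c. mul a (b + c) = mul a b + mul a c"
    and assoc: "\<And>a b c. mul (mul a b) c = mul a (mul b c)"
  defines "B \<equiv> \<lambda>a b. - (mul a b + mul b a)"
  shows "B (B (B a a) b) a = B (B a a) (B b a)"
proof -
  have zero: "mul 0 c = 0" "mul c 0 = 0" for c using add(1)[of 0 0 c] add(2)[of c 0 0] by auto
  have minus: "mul (- a) c = - mul a c" "mul c (- a) = - mul c a" for a c
    using add(1)[of "- a" a c] add(2)[of c "- a" a] zero by (simp_all add: eq_neg_iff_add_eq_0)
  show ?thesis unfolding B_def add minus assoc by (simp add: algebra_simps)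
qed

text \<open>Matrices are functions on all pairs of naturals and only the inner index is bounded, so
  the size can be an ordinary variable.\<close>

definition mat_mul :: "nat \<Rightarrow> (nat \<Rightarrow> nat \<Rightarrow> 'f::field) \<Rightarrow> (nat \<Rightarrow> nat \<Rightarrow> 'f) \<Rightarrow> nat \<Rightarrow> nat \<Rightarrow> 'f" where
  "mat_mul m A B i k = (\<Sum>j\<in>{1..m}. A i j * B j k)"

lemma mat_mul_add: "mat_mul m (A + B) C = mat_mul m A C + mat_mul m B C"
  "mat_mul m A (B + C) = mat_mul m A B + mat_mul m A C"
  by (simp_all add: fun_eq_iff mat_mul_def distrib_right distrib_left sum.distrib)

lemma mat_mul_assoc: "mat_mul m (mat_mul m A B) C = mat_mul m A (mat_mul m B C)"
proof (intro ext)
  fix i l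
  have "mat_mul m (mat_mul m A B) C i l = (\<Sum>k\<in>{1..m}. \<Sum>j\<in>{1..m}. A i j * B j k * C k l)"
    by (simp add: mat_mul_def sum_distrib_right)
  also have "\<dots> = (\<Sum>j\<in>{1..m}. \<Sum>k\<in>{1..m}. A i j * B j k * C k l)" by (rule sum.swap)
  also have "\<dots> = mat_mul m A (mat_mul m B C) i l"
    by (simp add: mat_mul_def sum_distrib_left mult.assoc)
  finally show "mat_mul m (mat_mul m A B) C i l = mat_mul m A (mat_mul m B C) i l" .
qed

text \<open>For a transposition \<open>(a b)\<close> this is minus the rank-one matrix of the vector \<open>e\<^sub>a - e\<^sub>b\<close>.\<close>

definition perm_mat :: "(nat \<Rightarrow> nat) \<Rightarrow> nat \<Rightarrow> nat \<Rightarrow> 'f::field" where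
  "perm_mat \<sigma> i j = of_bool (\<sigma> i = j) - of_bool (i = j)"

lemma mat_mul_perm_mat:
  assumes "\<sigma> permutes {1..m}"
  shows "mat_mul m (perm_mat \<sigma>) B i k = B (\<sigma> i) k - B i k"
proof (cases "i \<in> {1..m}")
  case True
  then have "\<sigma> i \<in> {1..m}" using assms permutes_in_image by metis
  moreover have "mat_mul m (perm_mat \<sigma>) B i k =
      (\<Sum>j\<in>{1..m}. (if \<sigma> i = j then B j k else 0)) - (\<Sum>j\<in>{1..m}. (if i = j then B j k else 0))"
    unfolding mat_mul_def perm_mat_def sum_subtractf[symmetric] by (intro sum.cong) auto
  ultimately show ?thesis using True by simp
next
  case False
  then have "\<sigma> i = i" using assms by (meson permutes_not_in)
  then show ?thesis by (simp add: mat_mul_def perm_mat_def)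
qed

definition perm_prod :: "nat \<Rightarrow> (nat \<Rightarrow> nat \<Rightarrow> 'f::field) \<Rightarrow> (nat \<Rightarrow> nat \<Rightarrow> 'f) \<Rightarrow> nat \<Rightarrow> nat \<Rightarrow> 'f" where
  "perm_prod m A B = - (mat_mul m A B + mat_mul m B A)"

lemma perm_prod_perm_mat:
  assumes "\<sigma> permutes {1..m}" "\<tau> permutes {1..m}"
  shows "perm_prod m (perm_mat \<sigma>) (perm_mat \<tau>) i k =
    - (of_bool (\<tau> (\<sigma> i) = k) + of_bool (\<sigma> (\<tau> i) = k) - 2 * of_bool (\<sigma> i = k) - 2 * of_bool (\<tau> i = k)
       + 2 * of_bool (i = k) :: 'f::field)"
proof -
  have "- ((ts - s) - (t - e) + ((st - t) - (s - e))) = - (ts + st - 2 * s - 2 * t + 2 * e)" for ts s t e st :: 'f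
    by (simp add: algebra_simps)
  then show ?thesis
    unfolding perm_prod_def uminus_apply plus_fun_apply mat_mul_perm_mat[OF assms(1)] mat_mul_perm_mat[OF assms(2)]
      perm_mat_def .
qed

text \<open>With \<open>X\<close> the transposition matrix minus the identity, the square of
  \<open>X\<close> is \<open>-2 X\<close>, so the product is \<open>4 X\<close>; characteristic 3
  makes this \<open>X\<close>.\<close>

lemma perm_prod_same:
  assumes "CHAR('f::field) = 3" and "a \<in> {1..m}" "b \<in> {1..m}"
  shows "perm_prod m (perm_mat (transpose a b)) (perm_mat (transpose a b)) = (perm_mat (transpose a b) :: _ \<Rightarrow> _ \<Rightarrow> 'f)"
proof (intro ext)
  fix i k
  have p: "transpose a b permutes {1..m}" using assms by (simp add: permutes_swap_id)
  have "perm_prod m (perm_mat (transpose a b)) (perm_mat (transpose a b)) i k =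
      (perm_mat (transpose a b) i k :: 'f) + 3 * perm_mat (transpose a b) i k"
    unfolding perm_prod_perm_mat[OF p p] by (simp add: perm_mat_def)
  then show "perm_prod m (perm_mat (transpose a b)) (perm_mat (transpose a b)) i k =
      (perm_mat (transpose a b) i k :: 'f)"
    using char3[OF assms(1)] by simp
qed

text \<open>The vectors of disjoint transpositions are orthogonal, so both matrix products
  vanish.\<close>

lemma perm_prod_disjoint:
  assumes "{a, b, c, d} \<subseteq> {1..m}" and "distinct [a, b, c, d]"
  shows "perm_prod m (perm_mat (transpose a b)) (perm_mat (transpose c d)) = (0 :: _ \<Rightarrow> _ \<Rightarrow> 'f::field)"
proof (intro ext)
  fix i k
  have p: "transpose a b permutes {1..m}" "transpose c d permutes {1..m}"
    using assms by (auto simp: permutes_swap_id)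
  show "perm_prod m (perm_mat (transpose a b)) (perm_mat (transpose c d)) i k = (0 :: _ \<Rightarrow> _ \<Rightarrow> 'f) i k"
    unfolding perm_prod_perm_mat[OF p] using assms(2) by (auto simp: transpose_def)
qed

text \<open>The three transpositions and the three even permutations of \<open>{a, b, c}\<close>
  have the same sum of matrices: all ones on these indices, three times the identity elsewhere. This
  trades the two 3-cycles in the expansion for transpositions and the identity.\<close>

lemma perm_prod_triangle:
  assumes "{a, b, c} \<subseteq> {1..m}" and ne: "a \<noteq> b" "b \<noteq> c" "a \<noteq> c"
  shows "perm_prod m (perm_mat (transpose a b)) (perm_mat (transpose b c)) =
    (perm_mat (transpose a b) + perm_mat (transpose b c) - perm_mat (transpose a c) :: _ \<Rightarrow> _ \<Rightarrow> 'f::field)"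
proof (intro ext)
  fix i k
  have p: "transpose a b permutes {1..m}" "transpose b c permutes {1..m}"
    using assms by (auto simp: permutes_swap_id)
  consider "i = a" | "i = b" | "i = c" | "i \<notin> {a, b, c}" by blast
  then show "perm_prod m (perm_mat (transpose a b)) (perm_mat (transpose b c)) i k =
      (perm_mat (transpose a b) + perm_mat (transpose b c) - perm_mat (transpose a c) :: _ \<Rightarrow> _ \<Rightarrow> 'f) i k"
    unfolding perm_prod_perm_mat[OF p] minus_apply plus_fun_apply perm_mat_def
    by cases (use ne in \<open>simp_all add: transpose_def\<close>)
qed

text \<open>Lines are unordered, while \<open>perm_prod_triangle\<close> wants the shared index in
  the middle; the vertices are renamed accordingly.\<close>

lemma triangle_orient:
  assumes "{\<sigma>, \<tau>, \<rho>} = {transpose i j, transpose j k, transpose i k}" "\<sigma> \<noteq> \<tau>" "\<sigma> \<noteq> \<rho>" "\<tau> \<noteq> \<rho>"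
    and "i \<noteq> j" "j \<noteq> k" "i \<noteq> k"
  shows "\<exists>a b c. {a, b, c} = {i, j, k} \<and> a \<noteq> b \<and> b \<noteq> c \<and> a \<noteq> c \<and>
    \<sigma> = transpose a b \<and> \<tau> = transpose b c \<and> \<rho> = transpose a c"
proof -
  have mem: "\<sigma> \<in> {transpose i j, transpose j k, transpose i k}" "\<tau> \<in> {transpose i j, transpose j k, transpose i k}"
    "\<rho> \<in> {transpose i j, transpose j k, transpose i k}" unfolding assms(1)[symmetric] by simp_all
  let ?P = "\<lambda>a b c. {a, b, c} = {i, j, k} \<and> a \<noteq> b \<and> b \<noteq> c \<and> a \<noteq> c \<and>
    \<sigma> = transpose a b \<and> \<tau> = transpose b c \<and> \<rho> = transpose a c"
  have "?P i j k \<or> ?P i k j \<or> ?P j i k \<or> ?P j k i \<or> ?P k i j \<or> ?P k j i"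
    using mem assms(2-) by (auto simp: transpose_commute insert_commute)
  then show ?thesis by blast
qed

lemma (in pts) symmetric_jordan:
  fixes \<delta> :: "'f::field"
  assumes char: "CHAR('f) = 3" and \<delta>: "\<delta> = 1 / 4"
    and iso: "isomorphic_systems P L (transpositions m) (fischer_lines (sym_group m) (transpositions m))"
  shows "jordan_algebra pm_scale (matsuo_carrier P) (matsuo_mult L \<delta>)"
proof -
  have "L \<subseteq> Pow P" using line_subset by blast
  then obtain f where f: "bij_betw f P (transpositions m)"
    "\<And>p q r. p \<in> P \<Longrightarrow> q \<in> P \<Longrightarrow> r \<in> P \<Longrightarrow>
      {f p, f q, f r} \<in> fischer_lines (sym_group m) (transpositions m) \<longleftrightarrow> {p, q, r} \<in> L"
    using isomorphic_systemsE[OF iso] by metis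
  have inj: "inj_on f P" and im: "f ` P = transpositions m" using f(1) by (auto simp: bij_betw_def)
  define sc :: "'f \<Rightarrow> (nat \<Rightarrow> nat \<Rightarrow> 'f) \<Rightarrow> nat \<Rightarrow> nat \<Rightarrow> 'f" where "sc c A = (\<lambda>i j. c * A i j)" for c A
  have vs: "vector_space sc"
    by unfold_locales (simp_all add: sc_def fun_eq_iff algebra_simps)
  interpret V: vector_space sc by (rule vs)
  define \<phi> :: "'a \<Rightarrow> nat \<Rightarrow> nat \<Rightarrow> 'f" where "\<phi> p = perm_mat (f p)" for p
  have transE: "\<exists>a b. a \<in> {1..m} \<and> b \<in> {1..m} \<and> a \<noteq> b \<and> f p = transpose a b" if "p \<in> P" for p
    using im that unfolding transpositions_def by blast
  show ?thesis
  proof (rule jordan_algebra_transfer[where sc = sc and B = "perm_prod m" and \<phi> = \<phi>])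
    show "vector_space sc" by (rule vs)
    show "perm_prod m (A + B) C = perm_prod m A C + perm_prod m B C"
      "perm_prod m A (B + C) = perm_prod m A B + perm_prod m A C" for A B C :: "nat \<Rightarrow> nat \<Rightarrow> 'f"
      unfolding perm_prod_def mat_mul_add by (simp_all add: algebra_simps)
    show "perm_prod m (sc c A) B = sc c (perm_prod m A B)" "perm_prod m A (sc c B) = sc c (perm_prod m A B)"
      for c and A B :: "nat \<Rightarrow> nat \<Rightarrow> 'f"
      unfolding perm_prod_def by (simp_all add: fun_eq_iff sc_def mat_mul_def sum_distrib_left algebra_simps)
    show "perm_prod m (perm_prod m (perm_prod m A A) B) A = perm_prod m (perm_prod m A A) (perm_prod m B A)"
      for A B :: "nat \<Rightarrow> nat \<Rightarrow> 'f"
      unfolding perm_prod_def by (rule associative_jordan) (fact mat_mul_add mat_mul_assoc)+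
  next
    fix p q assume pq: "p \<in> P" "q \<in> P"
    let ?F = "linear_extension sc \<phi> :: _ \<Rightarrow> nat \<Rightarrow> nat \<Rightarrow> 'f"
    have F: "?F (x + y) = ?F x + ?F y" "?F (axis p) = \<phi> p" for x y p
      by (rule V.linear_extension_add, rule V.linear_extension_axis)
    have Fm: "?F (x - y) = ?F x - ?F y" for x y using F(1)[of "x - y" y] by (simp add: algebra_simps)
    have d1: "\<delta> = 1" using \<delta> char3_quarter[OF char] by simp
    obtain a b where ab: "a \<in> {1..m}" "b \<in> {1..m}" "a \<noteq> b" "f p = transpose a b" using transE[OF pq(1)] by blast
    obtain c d where cd: "c \<in> {1..m}" "d \<in> {1..m}" "c \<noteq> d" "f q = transpose c d" using transE[OF pq(2)] by blast
    consider "p = q" | "p \<noteq> q" "col p q" | "p \<noteq> q" "\<not> col p q" by blast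
    then show "?F (axis_mult L \<delta> p q) = perm_prod m (\<phi> p) (\<phi> q)"
    proof cases
      case 1
      then show ?thesis using perm_prod_same[OF char ab(1,2)] ab(4) by (simp add: axis_mult_def F \<phi>_def)
    next
      case 2
      define r where "r = third p q"
      have l: "{p, q, r} \<in> L" using third_line 2 unfolding r_def by simp
      then have r: "r \<in> P" "p \<noteq> r" "q \<noteq> r" using line_points line_distinct by blast+
      have "axis_mult L \<delta> p q = axis p + axis q - axis r"
        unfolding d1 matsuo_mult_axis[symmetric] by (rule axis_line[OF l])
      then have F_eq: "?F (axis_mult L \<delta> p q) = \<phi> p + \<phi> q - \<phi> r" by (simp add: F Fm)
      have "{f p, f q, f r} \<in> fischer_lines (sym_group m) (transpositions m)" using f(2) pq r l by simp
      then obtain i j k where ijk: "{f p, f q, f r} = {transpose i j, transpose j k, transpose i k}"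
        "i \<in> {1..m}" "j \<in> {1..m}" "k \<in> {1..m}" "i \<noteq> j" "j \<noteq> k" "i \<noteq> k"
        unfolding fischer_lines_transpositions by blast
      moreover have "f p \<noteq> f q" "f p \<noteq> f r" "f q \<noteq> f r" using inj pq r 2 by (auto dest: inj_onD)
      ultimately obtain x y z where xyz: "{x, y, z} = {i, j, k}" "x \<noteq> y" "y \<noteq> z" "x \<noteq> z"
        "f p = transpose x y" "f q = transpose y z" "f r = transpose x z"
        using triangle_orient[of "f p" "f q" "f r" i j k] by metis
      then have "{x, y, z} \<subseteq> {1..m}" using ijk by simp
      then show ?thesis unfolding F_eq \<phi>_def xyz(5-7) using perm_prod_triangle xyz(2-4) by metis
    next
      case 3
      have "f p \<noteq> f q" using inj pq 3 by (auto dest: inj_onD)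
      have "distinct [a, b, c, d]"
      proof (rule ccontr)
        assume "\<not> distinct [a, b, c, d]"
        moreover have "{a, b} \<noteq> {c, d}"
          using \<open>f p \<noteq> f q\<close> ab cd transpose_eq_iff_doubleton[of a b c d] by simp
        \<comment> \<open>Distinct edges that are not disjoint share a vertex; the third
          transposition of that triangle would make \<open>p\<close> and \<open>q\<close>
          collinear.\<close>
        ultimately have "\<exists>x y z. {x, y, z} \<subseteq> {1..m} \<and> x \<noteq> y \<and> y \<noteq> z \<and> x \<noteq> z \<and> {a, b} = {x, y} \<and> {c, d} = {y, z}"
          using ab cd by (auto simp: doubleton_eq_iff)
        then obtain x y z where xyz: "x \<in> {1..m}" "y \<in> {1..m}" "z \<in> {1..m}" "x \<noteq> y" "y \<noteq> z" "x \<noteq> z"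
          "f p = transpose x y" "f q = transpose y z"
          using ab cd transpose_eq_iff_doubleton by (metis insert_subset)
        then have "transpose x z \<in> transpositions m" unfolding transpositions_def by blast
        then obtain r where r: "r \<in> P" "f r = transpose x z" using im by (metis imageE)
        have "{f p, f q, f r} \<in> fischer_lines (sym_group m) (transpositions m)"
          unfolding fischer_lines_transpositions xyz(7,8) r(2) using xyz(1-6) by blast
        then have "{p, q, r} \<in> L" using f(2)[OF pq r(1)] by blast
        then show False using 3 line_col by blast
      qed
      then have "perm_prod m (\<phi> p) (\<phi> q) = 0"
        unfolding \<phi>_def ab(4) cd(4) using ab cd by (intro perm_prod_disjoint) auto
      then show ?thesis using 3 by (simp add: axis_mult_def linear_extension_def)
    qed
  next
    fix x :: "'a \<Rightarrow>\<^sub>0 'f" assume x: "x \<in> matsuo_carrier P" "linear_extension sc \<phi> x = 0"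
    show "x = 0"
    proof (rule poly_mapping_eqI)
      fix p
      show "Poly_Mapping.lookup x p = Poly_Mapping.lookup 0 p"
      proof (cases "p \<in> Poly_Mapping.keys x")
        case True
        then have "p \<in> P" using x(1) unfolding matsuo_carrier_def by blast
        then obtain a b where ab: "a \<in> {1..m}" "b \<in> {1..m}" "a \<noteq> b" "f p = transpose a b" using transE by blast
        have sum_apply: "(\<Sum>q\<in>A. g q) a b = (\<Sum>q\<in>A. g q a b)" for g :: "'a \<Rightarrow> nat \<Rightarrow> nat \<Rightarrow> 'f" and A
          by (induction A rule: infinite_finite_induct) auto
        \<comment> \<open>At the off-diagonal entry \<open>a, b\<close> only the transposition of
          \<open>a\<close> and \<open>b\<close> has a nonzero matrix, so this entry isolates the
          coefficient of \<open>p\<close>.\<close>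
        have "(0::'f) = linear_extension sc \<phi> x a b" using x(2) by simp
        also have "\<dots> = (\<Sum>q\<in>Poly_Mapping.keys x. if q = p then Poly_Mapping.lookup x q else 0)"
          unfolding linear_extension_def sum_apply
        proof (rule sum.cong)
          fix q assume "q \<in> Poly_Mapping.keys x"
          then have q: "q \<in> P" using x(1) unfolding matsuo_carrier_def by blast
          obtain c d where cd: "c \<noteq> d" "f q = transpose c d" using transE[OF q] by blast
          have "f q a = b \<longleftrightarrow> f q = f p"
          proof
            assume "f q a = b"
            then have "{c, d} = {a, b}" using cd ab(3) by (auto simp: transpose_def split: if_splits)
            then show "f q = f p" using cd ab transpose_eq_iff_doubleton[of c d a b] by simp
          qed (use ab in simp)
          also have "\<dots> \<longleftrightarrow> q = p" using inj q \<open>p \<in> P\<close> by (rule inj_on_eq_iff)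
          finally show "sc (Poly_Mapping.lookup x q) (\<phi> q) a b = (if q = p then Poly_Mapping.lookup x q else 0)"
            using ab(3) by (simp add: sc_def \<phi>_def perm_mat_def)
        qed simp
        also have "\<dots> = Poly_Mapping.lookup x p" using True by simp
        finally show ?thesis by simp
      qed (simp add: not_in_keys_iff_lookup_eq_zero)
    qed
  qed
qed

section \<open>The classification\<close>

theorem mainTheorem1:
  fixes n :: nat and P :: "'a set" and L :: "'a set set"
  assumes "n > 0"
    and "fischer_space P L"
    and "connected_system P L"
    and "has_rank P L n"
    and "CHAR('f::field) = 3"
  shows "jordan_algebra pm_scale (matsuo_carrier P) (matsuo_mult L (1 / 4 :: 'f)) \<longleftrightarrow>
    isomorphic_systems P L
      (transpositions (n + 1)) (fischer_lines (sym_group (n + 1)) (transpositions (n + 1))) \<or>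
    isomorphic_systems P L (affine_points (n - 1)) (affine_lines (n - 1))"
proof
  interpret pts P L using assms(2) unfolding fischer_space_def by unfold_locales simp
  assume jordan: "jordan_algebra pm_scale (matsuo_carrier P) (matsuo_mult L (1 / 4 :: 'f))"
  interpret jordan_fischer P L "1 / 4 :: 'f"
    by unfold_locales (use assms jordan in auto)
  show "isomorphic_systems P L
      (transpositions (n + 1)) (fischer_lines (sym_group (n + 1)) (transpositions (n + 1))) \<or>
    isomorphic_systems P L (affine_points (n - 1)) (affine_lines (n - 1))"
  \<comment> \<open>For \<open>n \<le> 2\<close> the space is a point or a line and has no planes;
    these cases fall into the second branch, where the two models coincide up to
    isomorphism.\<close>
  proof (cases "\<exists>Q. affine_plane Q")
    case True
    interpret jordan_affine_fischer P L "1 / 4 :: 'f" by unfold_locales (rule True)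
    show ?thesis using has_rank_affine[OF assms(1,4)] by simp
  next
    case False
    interpret jordan_dual_fischer P L "1 / 4 :: 'f" by unfold_locales (use False in blast)
    obtain g where "edge_labelling (n + 1) g" "edge_points (n + 1) g = P"
      by (rule has_rank_edge_labelling[OF assms(1,4)])
    then show ?thesis using edge_labelling_isomorphic by blast
  qed
next
  interpret pts P L using assms(2) unfolding fischer_space_def by unfold_locales simp
  assume "isomorphic_systems P L
      (transpositions (n + 1)) (fischer_lines (sym_group (n + 1)) (transpositions (n + 1))) \<or>
    isomorphic_systems P L (affine_points (n - 1)) (affine_lines (n - 1))"
  then show "jordan_algebra pm_scale (matsuo_carrier P) (matsuo_mult L (1 / 4 :: 'f))"
    using symmetric_jordan[OF assms(5) refl] affine_jordan[OF assms(5) refl] by blast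
qed

end
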